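(* Suppose $u$ is a parallel refractor, the target $\Sigma$ is regular from $X^\star=(x^\star,u(x^\star))\in C_\Omega$, and there exist constants $C_0>0$ and $1\le q<\frac{n}{n-1}$ such that $\sigma(F_u(B_\eta))\le C_0\,\eta^{n/q}$ for all balls $B_\eta\subseteq\Omega$ of radius $\eta$. Suppose in addition that the tube condition holds at $X^\star$. Let $$\alpha=\frac{\frac{n}{2q}-\frac{n-1}{2}}{1+\frac32(n-1)+\frac{n}{2q}}.$$ Then there exist positive constants $\delta$ and $C$, depending on $X^\star$, such that $u\in C^{1,\alpha}(B_\delta(x^\star))$ with $|Du(\bar x)-Du(\hat x)|\le C|\bar x-\hat x|^\alpha$ for all $\hat x,\bar x\in B_\delta(x^\star)$.
   Context: Fix an integer $n\ge2$, constants $0<\kappa<1$, $M_0>0$, $0<\delta_0<1$, and a bounded domain $\Omega\subset\mathbb{R}^n$. Points of $\mathbb{R}^{n+1}$ are written $X=(x,x_{n+1})$ with $x\in\mathbb{R}^n$ (likewise $Y=(y,y_{n+1})$, $Z=(z,z_{n+1})$, $X_0=(x_0,x_{0,n+1})$); $B_r(a)$ is the ball of radius $r$ centered at $a$, and $N_\rho(E)$ is the $\rho$-neighborhood of $E$ in $\mathbb{R}^{n+1}$. Set $C_\Omega=\Omega\times(0,M_0)$, $$c(X,Y)=|X-Y|+\kappa(x_{n+1}-y_{n+1}),$$ $$\phi(x,Y,X_0)=y_{n+1}-\frac{\kappa\,c(X_0,Y)}{1-\kappa^2}-\sqrt{\frac{c(X_0,Y)^2}{(1-\kappa^2)^2}-\frac{|x-y|^2}{1-\kappa^2}}\quad\text{for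 } |x-y|\le \frac{c(X_0,Y)}{\sqrt{1-\kappa^2}}.$$ $D_x\phi$ is the gradient in $x$. Let $\mathcal T$ be the set of $Y\in\mathbb{R}^{n+1}$ such that for every $X_0\in C_\Omega$: $x_{0,n+1}\le y_{n+1}-\frac{\kappa c(X_0,Y)}{1-\kappa^2}$ and $\Omega\subset B_{\delta_0c(X_0,Y)/\sqrt{1-\kappa^2}}(y)$. For $v\in\mathbb{R}^n$ let $$Q(v)=\frac{\sqrt{1+(1-\kappa^2)|v|^2}-\kappa}{1+|v|^2},\qquad \Lambda(v)=(-Q(v)v,\;Q(v)+\kappa),$$ a unit vector. Target: $\Sigma\subset\mathbb{R}^{n+1}$ is a domain contained in an $n$-dimensional surface, its convex hull is contained in $\mathcal T$, and for each $X\in C_\Omega$ every $Y\in\Sigma$ is represented parametrically from $X$ as $Y=X+s_X(\Lambda)\Lambda$, $|\Lambda|=1$, with $s_X$ a positive function of the direction that is Lipschitz and of class $C^2$. $\sigma$ is a Borel measure on $\Sigma$. For $\bar Y,\hat Y\in\Sigma$ and $Z\in C_\Omega$ put $\bar v=D_x\phi(z,\bar Y,Z)$, $\hat v=D_x\phi(z,\hat Y,Z)$, $v(\lambda)=(1-\lambda)\bar v+\lambda\hat v$, and $Y_Z(\lambda)=Z+s_Z(\Lambda(v(\lambda)))\Lambda(v(\lambda))$. It is assumed that $[\bar Y,\hat Y]_Z:=\Sigma\cap\{Z+s\Lambda(v(\lambda)):s>0,\lambda\in[0,1]\}$ is a curve, i.e. for every $\lambda\in[0,1]$ the ray from $Z$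 in direction $\Lambda(v(\lambda))$ meets $\Sigma$, at the single point $Y_Z(\lambda)$. Regularity of the target: $\Sigma$ is regular from $X_0\in C_\Omega$ if there exist a neighborhood $U_{X_0}$ of $X_0$ and positive constants $c_1,c_2$, depending on $U_{X_0}$, such that for all $\bar Y,\hat Y\in\Sigma$, $Z\in U_{X_0}$, $1/4\le\lambda\le3/4$ and $x\in\Omega$ with $|x-z|\le c_2$, $$\phi(x,Y_Z(\lambda),Z)\ge\min\{\phi(x,\bar Y,Z),\phi(x,\hat Y,Z)\}+c_1|\bar Y-\hat Y|^2|x-z|^2.$$ Tube condition at $X_0\in C_\Omega$: there exist a neighborhood $U_{X_0}$ of $X_0$ and a constant $\hat C>0$, depending on $X_0$, such that $$\sigma\big(N_\rho(\{Y_Z(\lambda):\lambda\in[1/4,3/4]\})\cap\Sigma\big)\ge\hat C\,\rho^{n-1}|\bar Y-\hat Y|$$ for all $\bar Y,\hat Y\in\Sigma$, all $Z\in U_{X_0}$ and all sufficiently small $\rho>0$ (smallness depending on $X_0$). Parallel refractor: a function $u:\Omega\to[0,M_0]$ such that for every $x_0\in\Omega$ the set $F_u(x_0)=\{Y\in\Sigma: u(x)\le\phi(x,Y,X_0)\ \text{for all }x\in\Omega\}$, $X_0=(x_0,u(x_0))$, is nonempty. For $B\subset\Omega$, $F_u(B)=\bigcup_{x\in B}F_u(x)$. *)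

theory Defs
  imports "HOL-Analysis.Analysis"
begin

text \<open>
  Points of $\mathbb{R}^{n+1}$ are pairs $X = (x, x_{n+1})$, with \<open>n = CARD('n)\<close>; the norm on the
  product type is the Euclidean one.
\<close>

type_synonym 'n point = "(real^'n) \<times> real"


subsection \<open>Calculus and surfaces\<close>

definition gradient :: "('a::real_inner \<Rightarrow> real) \<Rightarrow> 'a \<Rightarrow> 'a" where
  "gradient f x = (THE D. GDERIV f x :> D)"

lemma gradient_eqI: "GDERIV f x :> D \<Longrightarrow> gradient f x = D"
  unfolding gradient_def
proof (rule the_equality)
  fix D' assume D: "GDERIV f x :> D" and D': "GDERIV f x :> D'"
  have "(\<bullet>) D' = (\<bullet>) D"
    using has_derivative_unique[OF D'[unfolded gderiv_def] D[unfolded gderiv_def]]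
    by (simp add: fun_eq_iff inner_commute)
  then show "D' = D" by (metis inner_eq_zero_iff inner_diff_left right_minus_eq)
qed

definition C2_on :: "'a::real_normed_vector set \<Rightarrow> ('a \<Rightarrow> real) \<Rightarrow> bool" where
  "C2_on U f \<longleftrightarrow>
     (\<exists>(f' :: 'a \<Rightarrow> 'a \<Rightarrow>\<^sub>L real) (f'' :: 'a \<Rightarrow> 'a \<Rightarrow>\<^sub>L 'a \<Rightarrow>\<^sub>L real).
        (\<forall>x\<in>U. (f has_derivative blinfun_apply (f' x)) (at x)
             \<and> (f' has_derivative blinfun_apply (f'' x)) (at x))
        \<and> continuous_on U f'')"

text \<open>
  Class $C^2$ for a function given on a not necessarily open set \<open>D\<close> (below, a set of unit vectors):
  locally the restriction of a $C^2$ function on an open set of the ambient space.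
\<close>

definition C2_on_subset :: "'a::real_normed_vector set \<Rightarrow> ('a \<Rightarrow> real) \<Rightarrow> bool" where
  "C2_on_subset D f \<longleftrightarrow>
     (\<forall>p\<in>D. \<exists>U g. open U \<and> p \<in> U \<and> C2_on U g \<and> (\<forall>x \<in> D \<inter> U. g x = f x))"

text \<open>Membership in $C^{1,\alpha}(U)$, \<open>U\<close> open, with finite norm.\<close>

definition C1_Holder_on :: "real \<Rightarrow> 'a::real_inner set \<Rightarrow> ('a \<Rightarrow> real) \<Rightarrow> bool" where
  "C1_Holder_on \<alpha> U u \<longleftrightarrow>
     (\<forall>x\<in>U. u differentiable (at x)) \<and> continuous_on U (gradient u)
     \<and> bounded (u ` U) \<and> bounded (gradient u ` U)
     \<and> (\<exists>C. \<forall>x\<in>U. \<forall>y\<in>U. norm (gradient u x - gradient u y) \<le> C * norm (x - y) powr \<alpha>)"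

text \<open>
  An $n$-dimensional surface in $\mathbb{R}^{n+1}$ is understood topologically. Smoothness of the
  target enters only through the $C^2$ radial parametrizations below.
\<close>

definition surface :: "'n::finite point set \<Rightarrow> bool" where
  "surface M \<longleftrightarrow>
     (\<forall>p\<in>M. \<exists>V (W :: (real^'n) set).
        openin (top_of_set M) V \<and> p \<in> V \<and> open W \<and> V homeomorphic W)"

definition surface_domain :: "'n::finite point set \<Rightarrow> bool" where
  "surface_domain \<S> \<longleftrightarrow>
     (\<exists>M. surface M \<and> openin (top_of_set M) \<S>) \<and> connected \<S> \<and> \<S> \<noteq> {}"

definition nbhd :: "real \<Rightarrow> 'a::metric_space set \<Rightarrow> 'a set" where
  "nbhd \<rho> E = (\<Union>e\<in>E. ball e \<rho>)"


subsection \<open>Refracting ellipsoids\<close>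

definition cyl :: "(real^'n::finite) set \<Rightarrow> real \<Rightarrow> 'n point set" where
  "cyl \<Omega> M0 = \<Omega> \<times> {0<..<M0}"

definition cost :: "real \<Rightarrow> 'n::finite point \<Rightarrow> 'n point \<Rightarrow> real" where
  "cost \<kappa> X Y = norm (X - Y) + \<kappa> * (snd X - snd Y)"

text \<open>
  \<open>phi\<close> is meaningful only for $|x-y| \le c(X_0,Y)/\sqrt{1-\kappa^2}$. For \<open>Y\<close> in the set
  \<open>targets\<close> and $X_0 \in C_\Omega$ this holds, with strict inequality, at every $x \in \Omega$.
\<close>

definition phi :: "real \<Rightarrow> real^'n::finite \<Rightarrow> 'n point \<Rightarrow> 'n point \<Rightarrow> real" where
  "phi \<kappa> x Y X0 =
     snd Y - \<kappa> * cost \<kappa> X0 Y / (1 - \<kappa>\<^sup>2)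
       - sqrt ((cost \<kappa> X0 Y)\<^sup>2 / (1 - \<kappa>\<^sup>2)\<^sup>2 - (norm (x - fst Y))\<^sup>2 / (1 - \<kappa>\<^sup>2))"

definition targets :: "real \<Rightarrow> real \<Rightarrow> real \<Rightarrow> (real^'n::finite) set \<Rightarrow> 'n point set" where
  "targets \<kappa> M0 \<delta>0 \<Omega> =
     {Y. \<forall>X0 \<in> cyl \<Omega> M0.
           snd X0 \<le> snd Y - \<kappa> * cost \<kappa> X0 Y / (1 - \<kappa>\<^sup>2)
         \<and> \<Omega> \<subseteq> ball (fst Y) (\<delta>0 * cost \<kappa> X0 Y / sqrt (1 - \<kappa>\<^sup>2))}"

definition Q :: "real \<Rightarrow> real^'n::finite \<Rightarrow> real" where
  "Q \<kappa> v = (sqrt (1 + (1 - \<kappa>\<^sup>2) * (norm v)\<^sup>2) - \<kappa>) / (1 + (norm v)\<^sup>2)"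

definition Lam :: "real \<Rightarrow> real^'n::finite \<Rightarrow> 'n point" where
  "Lam \<kappa> v = (- (Q \<kappa> v *\<^sub>R v), Q \<kappa> v + \<kappa>)"


subsection \<open>The target\<close>

definition directions :: "'n::finite point set \<Rightarrow> 'n point \<Rightarrow> 'n point set" where
  "directions \<S> X = (\<lambda>Y. sgn (Y - X)) ` \<S>"

text \<open>
  \<open>s X\<close> is the radial function $s_X$; only its values on the unit vectors \<open>directions \<S> X\<close> matter.
\<close>

definition radial_param :: "'n::finite point set \<Rightarrow> 'n point \<Rightarrow> ('n point \<Rightarrow> real) \<Rightarrow> bool" where
  "radial_param \<S> X sX \<longleftrightarrow>
     (\<forall>Y\<in>\<S>. \<exists>\<Lambda> \<in> directions \<S> X. norm \<Lambda> = 1 \<and> Y = X + sX \<Lambda> *\<^sub>R \<Lambda>)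
     \<and> (\<forall>\<Lambda> \<in> directions \<S> X. sX \<Lambda> > 0)
     \<and> (\<exists>L. L-lipschitz_on (directions \<S> X) sX)
     \<and> C2_on_subset (directions \<S> X) sX"

definition slope :: "real \<Rightarrow> 'n::finite point \<Rightarrow> 'n point \<Rightarrow> real^'n" where
  "slope \<kappa> Z Y = gradient (\<lambda>x. phi \<kappa> x Y Z) (fst Z)"

definition dir_curve :: "real \<Rightarrow> 'n::finite point \<Rightarrow> 'n point \<Rightarrow> 'n point \<Rightarrow> real \<Rightarrow> 'n point" where
  "dir_curve \<kappa> Z Y1 Y2 l = Lam \<kappa> ((1 - l) *\<^sub>R slope \<kappa> Z Y1 + l *\<^sub>R slope \<kappa> Z Y2)"

text \<open>The point $Y_Z(\lambda)$ for \<open>Y1\<close> $= \bar Y$, \<open>Y2\<close> $= \hat Y$.\<close>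

definition Y_curve ::
  "real \<Rightarrow> ('n::finite point \<Rightarrow> 'n point \<Rightarrow> real) \<Rightarrow> 'n point \<Rightarrow> 'n point \<Rightarrow> 'n point \<Rightarrow> real \<Rightarrow> 'n point"
where
  "Y_curve \<kappa> s Z Y1 Y2 l =
     Z + s Z (dir_curve \<kappa> Z Y1 Y2 l) *\<^sub>R dir_curve \<kappa> Z Y1 Y2 l"

definition admissible_target ::
  "real \<Rightarrow> real \<Rightarrow> real \<Rightarrow> (real^'n::finite) set \<Rightarrow> 'n point set
     \<Rightarrow> ('n point \<Rightarrow> 'n point \<Rightarrow> real) \<Rightarrow> bool"
where
  "admissible_target \<kappa> M0 \<delta>0 \<Omega> \<S> s \<longleftrightarrow>
     surface_domain \<S>
     \<and> convex hull \<S> \<subseteq> targets \<kappa> M0 \<delta>0 \<Omega>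
     \<and> (\<forall>X \<in> cyl \<Omega> M0. radial_param \<S> X (s X))
     \<and> (\<forall>Y1\<in>\<S>. \<forall>Y2\<in>\<S>. \<forall>Z \<in> cyl \<Omega> M0. \<forall>l\<in>{0..1}.
          \<S> \<inter> {Z + t *\<^sub>R dir_curve \<kappa> Z Y1 Y2 l | t. t > 0} = {Y_curve \<kappa> s Z Y1 Y2 l})"

definition regular_from ::
  "real \<Rightarrow> real \<Rightarrow> (real^'n::finite) set \<Rightarrow> 'n point set
     \<Rightarrow> ('n point \<Rightarrow> 'n point \<Rightarrow> real) \<Rightarrow> 'n point \<Rightarrow> bool"
where
  "regular_from \<kappa> M0 \<Omega> \<S> s X0 \<longleftrightarrow>
     (\<exists>U c1 c2. open U \<and> X0 \<in> U \<and> U \<subseteq> cyl \<Omega> M0 \<and> c1 > 0 \<and> c2 > 0 \<and>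
        (\<forall>Y1\<in>\<S>. \<forall>Y2\<in>\<S>. \<forall>Z\<in>U. \<forall>l\<in>{1/4..3/4}. \<forall>x\<in>\<Omega>. norm (x - fst Z) \<le> c2 \<longrightarrow>
           phi \<kappa> x (Y_curve \<kappa> s Z Y1 Y2 l) Z
             \<ge> min (phi \<kappa> x Y1 Z) (phi \<kappa> x Y2 Z)
                + c1 * (norm (Y1 - Y2))\<^sup>2 * (norm (x - fst Z))\<^sup>2))"

definition tube_condition ::
  "real \<Rightarrow> real \<Rightarrow> (real^'n::finite) set \<Rightarrow> 'n point set
     \<Rightarrow> ('n point \<Rightarrow> 'n point \<Rightarrow> real) \<Rightarrow> 'n point measure \<Rightarrow> 'n point \<Rightarrow> bool"
where
  "tube_condition \<kappa> M0 \<Omega> \<S> s \<sigma> X0 \<longleftrightarrow>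
     (\<exists>U C \<rho>0. open U \<and> X0 \<in> U \<and> U \<subseteq> cyl \<Omega> M0 \<and> C > 0 \<and> \<rho>0 > 0 \<and>
        (\<forall>Y1\<in>\<S>. \<forall>Y2\<in>\<S>. \<forall>Z\<in>U. \<forall>\<rho>\<in>{0<..<\<rho>0}.
           emeasure \<sigma> (nbhd \<rho> (Y_curve \<kappa> s Z Y1 Y2 ` {1/4..3/4}) \<inter> \<S>)
             \<ge> ennreal (C * \<rho> ^ (CARD('n) - 1) * norm (Y1 - Y2))))"


subsection \<open>Parallel refractors\<close>

definition refr_map ::
  "real \<Rightarrow> (real^'n::finite) set \<Rightarrow> 'n point set \<Rightarrow> (real^'n \<Rightarrow> real) \<Rightarrow> real^'n \<Rightarrow> 'n point set"
where
  "refr_map \<kappa> \<Omega> \<S> u x0 = {Y\<in>\<S>. \<forall>x\<in>\<Omega>. u x \<le> phi \<kappa> x Y (x0, u x0)}"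

definition parallel_refractor ::
  "real \<Rightarrow> real \<Rightarrow> (real^'n::finite) set \<Rightarrow> 'n point set \<Rightarrow> (real^'n \<Rightarrow> real) \<Rightarrow> bool"
where
  "parallel_refractor \<kappa> M0 \<Omega> \<S> u \<longleftrightarrow>
     u \<in> \<Omega> \<rightarrow> {0..M0} \<and> (\<forall>x0\<in>\<Omega>. refr_map \<kappa> \<Omega> \<S> u x0 \<noteq> {})"

end

theory Submission
  imports Defs
begin

text \<open>
  Two facts make the theorem true.

  First, scaling the vertical axis by \<open>sqrt (1 - \<kappa>\<^sup>2)\<close> turns every
  ellipsoid of the family into a sphere. Hence the ellipsoid with focus \<open>Y\<close> through
  \<open>Z\<close> is, in the coordinates \<open>(w, \<omega>) = X - Z\<close>, the zero set of
  \<open>v \<bullet> w + t * ((norm w)\<^sup>2 + (1 - \<kappa>\<^sup>2) * \<omega>\<^sup>2) / 2 -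
  \<omega>\<close>, where \<open>v\<close> is the slope of the ellipsoid at \<open>Z\<close> and
  \<open>t\<close> is, for a given slope, proportional to the curvature of the sphere. This
  expression, called \<open>excess\<close> below, is affine in \<open>(v, t)\<close>, and its sign
  decides whether \<open>X\<close> lies outside the ellipsoid (lemma \<open>cost_excess\<close>).

  Second, a point \<open>Y\<close> belongs to \<open>F_u(x0)\<close> exactly when \<open>x0\<close>
  minimises the cost \<open>x \<mapsto> c((x, u x), Y)\<close> over \<open>\<Omega>\<close> (lemma
  \<open>F_iff\<close>). To exhibit many elements of \<open>F_u(B)\<close> it is therefore enough to
  bound this cost from below outside the ball \<open>B\<close>.

  Along the curve \<open>Y_Z(\<lambda>)\<close> the slope \<open>v\<close> is affine in
  \<open>\<lambda>\<close> by construction. Regularity of the target compares the ellipsoids only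
  near \<open>Z\<close>, but testing it along parabolas that are tangent to the intersection of the
  two extreme ellipsoids shows that \<open>t\<close> exceeds its affine interpolation by at least a
  multiple of \<open>|Y1 - Y2|^2\<close> (lemma \<open>regular_concave\<close>). Because
  \<open>excess\<close> is affine in \<open>(v, t)\<close>, this bound on \<open>t\<close> turns the
  local comparison into one that is valid over the whole of \<open>\<Omega>\<close> (lemma
  \<open>excess_tube\<close>).

  Let \<open>Y1 \<in> F_u(x1)\<close>, \<open>Y2 \<in> F_u(x2)\<close>, \<open>d = |Y1 - Y2|\<close>
  and \<open>\<Delta> = |x1 - x2|\<close>, with \<open>\<Delta> < d\<close>. Somewhere above the
  segment from \<open>x1\<close> to \<open>x2\<close> the two supporting ellipsoids meet, in a point
  \<open>Z\<close> that lies at most a multiple of \<open>d * \<Delta>\<close> above the graph of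
  \<open>u\<close> (lemma \<open>contact_point\<close>). On the other hand, for \<open>Y\<close>
  within \<open>\<rho>\<close> of the curve the excess at distance at least \<open>\<eta>\<close>
  from \<open>z\<close> is at least a multiple of \<open>d\<^sup>2 * \<eta>\<^sup>2\<close>,
  provided that \<open>\<rho>\<close> is a small multiple of \<open>d\<^sup>2 * \<eta>\<close>. With
  \<open>\<eta>\<^sup>2\<close> a large multiple of \<open>\<Delta> / d\<close> the second quantity
  dominates the first, and the whole \<open>\<rho>\<close>-tube about the curve lies in
  \<open>F_u(ball z \<eta>)\<close> (lemma \<open>tube_subset\<close>). The lower bound of the tube
  condition and the upper bound on \<open>\<sigma>(F_u(B))\<close> then give \<open>d * \<rho>^(n-1)
  \<le> const * \<eta> powr (n/q)\<close>, which solved for \<open>d\<close> is \<open>d \<le> const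
  * \<Delta> powr \<alpha>\<close> (lemma \<open>balance_exponents\<close>). Since the slope at a
  point of the graph is a Lipschitz function of that point and of the focus, the slopes of
  supporting ellipsoids at different points are Holder close, and this makes \<open>u\<close>
  differentiable with a Holder continuous gradient.
\<close>

section \<open>Ellipsoids as spheres\<close>

text \<open>
  Up to the factor \<open>1 - \<kappa>\<^sup>2\<close>, this is the vertical distance from
  \<open>Z\<close> to the centre of the ellipsoid with focus \<open>Y\<close> through
  \<open>Z\<close>; up to the same factor, it is the square root in the definition of
  \<open>phi\<close>, taken at the base point (see \<open>axial_sq\<close>).
\<close>

definition axial :: "real \<Rightarrow> 'n::finite point \<Rightarrow> 'n point \<Rightarrow> real" where
  "axial \<kappa> Z Y = snd Y - snd Z - \<kappa> * norm (Z - Y)"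

text \<open>
  The slope of the lower half of that ellipsoid at \<open>Z\<close>. Unlike \<open>slope\<close>, it
  is given by a formula, and \<open>slope_eq\<close> identifies the two.
\<close>

definition steepness :: "real \<Rightarrow> 'n::finite point \<Rightarrow> 'n point \<Rightarrow> real^'n" where
  "steepness \<kappa> Z Y = (1 / axial \<kappa> Z Y) *\<^sub>R (fst Z - fst Y)"

definition quad :: "real \<Rightarrow> 'n::finite point \<Rightarrow> real" where
  "quad \<kappa> W = (norm (fst W))\<^sup>2 + (1 - \<kappa>\<^sup>2) * (snd W)\<^sup>2"

text \<open>
  The defining polynomial of the ellipsoid with focus \<open>Y\<close> through \<open>Z\<close>, in
  coordinates centred at \<open>Z\<close> and normalised so that it is affine in the slope and in
  \<open>1 / axial\<close>.
\<close>

definition excess :: "real \<Rightarrow> 'n::finite point \<Rightarrow> 'n point \<Rightarrow> 'n point \<Rightarrow> real" where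
  "excess \<kappa> Z Y W = steepness \<kappa> Z Y \<bullet> fst W + 1 / axial \<kappa> Z Y * quad \<kappa> W / 2 - snd W"

lemma norm_point_sq: "(norm (X :: 'n::finite point))\<^sup>2 = (norm (fst X))\<^sup>2 + (snd X)\<^sup>2"
  by (simp add: norm_prod_def)

lemma axial_eq: "axial \<kappa> Z Y = (1 - \<kappa>\<^sup>2) * (snd Y - snd Z) - \<kappa> * cost \<kappa> Z Y"
  by (simp add: axial_def cost_def algebra_simps power2_eq_square)

text \<open>Squaring \<open>norm (X - Y) = c + \<kappa> * (y - x)\<close> leaves a quadratic relation without roots.\<close>

lemma cost_quadratic:
  "(1 - \<kappa>\<^sup>2) * (snd Y - snd X)\<^sup>2 - 2 * \<kappa> * (snd Y - snd X) * cost \<kappa> X Y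
     = (cost \<kappa> X Y)\<^sup>2 - (norm (fst X - fst Y))\<^sup>2"
proof -
  have "(norm (X - Y))\<^sup>2 = (norm (fst X - fst Y))\<^sup>2 + (snd X - snd Y)\<^sup>2"
    by (simp add: norm_point_sq)
  moreover have "norm (X - Y) = cost \<kappa> X Y + \<kappa> * (snd Y - snd X)"
    by (simp add: cost_def algebra_simps)
  ultimately have "(cost \<kappa> X Y + \<kappa> * (snd Y - snd X))\<^sup>2
      = (norm (fst X - fst Y))\<^sup>2 + (snd X - snd Y)\<^sup>2" by simp
  then show ?thesis by (simp add: algebra_simps power2_eq_square)
qed

lemma axial_sq:
  "(axial \<kappa> Z Y)\<^sup>2 = (cost \<kappa> Z Y)\<^sup>2 - (1 - \<kappa>\<^sup>2) * (norm (fst Z - fst Y))\<^sup>2"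
proof -
  define b where "b = snd Y - snd Z"
  define r where "r = norm (fst Z - fst Y)"
  define c where "c = cost \<kappa> Z Y"
  define k where "k = 1 - \<kappa>\<^sup>2"
  have "k * b\<^sup>2 - 2 * \<kappa> * b * c = c\<^sup>2 - r\<^sup>2"
    using cost_quadratic[of \<kappa> Y Z] by (simp add: b_def r_def c_def k_def)
  moreover have "(k * b - \<kappa> * c)\<^sup>2 = k * (k * b\<^sup>2 - 2 * \<kappa> * b * c) + \<kappa>\<^sup>2 * c\<^sup>2"
    by (simp add: algebra_simps power2_eq_square)
  ultimately have "(k * b - \<kappa> * c)\<^sup>2 = k * (c\<^sup>2 - r\<^sup>2) + (1 - k) * c\<^sup>2" by (simp add: k_def)
  then have "(k * b - \<kappa> * c)\<^sup>2 = c\<^sup>2 - k * r\<^sup>2" by (simp add: algebra_simps)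
  then show ?thesis by (simp add: axial_eq b_def r_def c_def k_def)
qed

text \<open>
  The quadratic relations at \<open>X\<close> and at \<open>Z\<close> have the same focus, so their
  difference is divisible by the difference of the costs. The other factor on the left is positive
  in all applications; the identity therefore converts estimates for the polynomial
  \<open>excess\<close> into estimates for the cost and back.
\<close>

lemma cost_excess:
  assumes "axial \<kappa> Z Y \<noteq> 0"
  shows "(cost \<kappa> X Y - cost \<kappa> Z Y) * (2 * \<kappa> * (snd Y - snd X) + cost \<kappa> X Y + cost \<kappa> Z Y)
    = 2 * axial \<kappa> Z Y * excess \<kappa> Z Y (X - Z)"
proof -
  define k where "k = 1 - \<kappa>\<^sup>2"
  define T where "T = axial \<kappa> Z Y"
  define c0 where "c0 = cost \<kappa> Z Y"
  define c1 where "c1 = cost \<kappa> X Y"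
  define b0 where "b0 = snd Y - snd Z"
  define b1 where "b1 = snd Y - snd X"
  define a where "a = fst Z - fst Y"
  define w where "w = fst X - fst Z"
  have 1: "k * b1\<^sup>2 - 2 * \<kappa> * b1 * c1 = c1\<^sup>2 - (norm (a + w))\<^sup>2"
    using cost_quadratic[of \<kappa> Y X] by (simp add: b1_def c1_def k_def a_def w_def)
  have 0: "k * b0\<^sup>2 - 2 * \<kappa> * b0 * c0 = c0\<^sup>2 - (norm a)\<^sup>2"
    using cost_quadratic[of \<kappa> Y Z] by (simp add: b0_def c0_def k_def a_def)
  have n: "(norm (a + w))\<^sup>2 = (norm a)\<^sup>2 + 2 * (a \<bullet> w) + (norm w)\<^sup>2"
    by (simp add: power2_norm_eq_inner inner_simps inner_commute)
  have T: "T = k * b0 - \<kappa> * c0" by (simp add: T_def axial_eq k_def b0_def c0_def)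
  have "2 * T * excess \<kappa> Z Y (X - Z)
      = 2 * (a \<bullet> w) + ((norm w)\<^sup>2 + k * (b0 - b1)\<^sup>2) - 2 * T * (b0 - b1)"
    using assms unfolding excess_def steepness_def quad_def
    by (simp add: T_def[symmetric] a_def[symmetric] w_def[symmetric] k_def[symmetric]
        field_simps b0_def b1_def)
  also have "\<dots> = (norm (a + w))\<^sup>2 - (norm a)\<^sup>2 + k * (b0 - b1)\<^sup>2 - 2 * (k * b0 - \<kappa> * c0) * (b0 - b1)"
    using n T by simp
  also have "\<dots> = (c1 - c0) * (2 * \<kappa> * b1 + c1 + c0)"
  proof -
    have e1: "(norm (a + w))\<^sup>2 = c1\<^sup>2 - k * b1\<^sup>2 + 2 * \<kappa> * b1 * c1" using 1 by simp
    have e0: "(norm a)\<^sup>2 = c0\<^sup>2 - k * b0\<^sup>2 + 2 * \<kappa> * b0 * c0" using 0 by simp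
    show ?thesis unfolding e1 e0 by (simp add: algebra_simps power2_eq_square)
  qed
  finally show ?thesis by (simp add: T_def c0_def c1_def b1_def)
qed

lemma snd_le_norm: "\<bar>snd X\<bar> \<le> norm (X :: 'n::finite point)"
  using norm_snd_le[of "snd X" "fst X"] by simp

lemma cost_ge:
  assumes "0 < \<kappa>"
  shows "(1 - \<kappa>) * norm (X - Y) \<le> cost \<kappa> X Y"
proof -
  have "\<kappa> * \<bar>snd (X - Y)\<bar> \<le> \<kappa> * norm (X - Y)"
    using snd_le_norm[of "X - Y"] assms by (simp add: mult_left_mono)
  moreover have "- (\<kappa> * \<bar>snd (X - Y)\<bar>) \<le> \<kappa> * snd (X - Y)"
    using assms mult_left_mono[of "- \<bar>snd (X - Y)\<bar>" "snd (X - Y)" \<kappa>] by simp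
  ultimately show ?thesis by (simp add: cost_def algebra_simps)
qed

lemma norm_diff_points:
  fixes X Y X' Y' :: "'a::real_normed_vector"
  shows "\<bar>norm (X - Y) - norm (X' - Y')\<bar> \<le> norm (X - X') + norm (Y - Y')"
proof -
  have "\<bar>norm (X - Y) - norm (X' - Y')\<bar> \<le> norm ((X - Y) - (X' - Y'))"
    by (rule norm_triangle_ineq3)
  also have "(X - Y) - (X' - Y') = (X - X') - (Y - Y')" by simp
  also have "norm \<dots> \<le> norm (X - X') + norm (Y - Y')" by (rule norm_triangle_ineq4)
  finally show ?thesis .
qed

lemma snd_diff_points:
  fixes X Y X' Y' :: "'n::finite point"
  shows "\<bar>(snd X - snd Y) - (snd X' - snd Y')\<bar> \<le> norm (X - X') + norm (Y - Y')"
  using snd_le_norm[of "X - X'"] snd_le_norm[of "Y - Y'"] by auto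

lemma cost_lipschitz:
  assumes "0 < \<kappa>" "\<kappa> < 1"
  shows "\<bar>cost \<kappa> X Y - cost \<kappa> X' Y'\<bar> \<le> 2 * (norm (X - X') + norm (Y - Y'))"
proof -
  define D where "D = norm (X - X') + norm (Y - Y')"
  have "\<bar>cost \<kappa> X Y - cost \<kappa> X' Y'\<bar>
     = \<bar>(norm (X - Y) - norm (X' - Y')) + \<kappa> * ((snd X - snd Y) - (snd X' - snd Y'))\<bar>"
    by (simp add: cost_def algebra_simps)
  also have "\<dots> \<le> D + \<kappa> * D"
    using norm_diff_points[of X Y X' Y'] snd_diff_points[of X Y X' Y'] assms
    by (intro order_trans[OF abs_triangle_ineq] add_mono) (auto simp: abs_mult D_def)
  also have "\<dots> \<le> 2 * D" using assms mult_right_mono[of \<kappa> 1 D] by (simp add: D_def)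
  finally show ?thesis by (simp add: D_def)
qed

lemma axial_lipschitz:
  assumes "0 < \<kappa>" "\<kappa> < 1"
  shows "\<bar>axial \<kappa> Z Y - axial \<kappa> Z' Y'\<bar> \<le> 2 * (norm (Z - Z') + norm (Y - Y'))"
proof -
  define D where "D = norm (Z - Z') + norm (Y - Y')"
  have "\<bar>axial \<kappa> Z Y - axial \<kappa> Z' Y'\<bar>
     = \<bar>((snd Z' - snd Y') - (snd Z - snd Y)) + \<kappa> * (norm (Z' - Y') - norm (Z - Y))\<bar>"
    by (simp add: axial_def algebra_simps)
  also have "\<dots> \<le> D + \<kappa> * D"
    using norm_diff_points[of Z' Y' Z Y] snd_diff_points[of Z' Y' Z Y] assms
    by (intro order_trans[OF abs_triangle_ineq] add_mono)
      (auto simp: abs_mult D_def norm_minus_commute)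
  also have "\<dots> \<le> 2 * D" using assms mult_right_mono[of \<kappa> 1 D] by (simp add: D_def)
  finally show ?thesis by (simp add: D_def)
qed

lemma phi_eq:
  assumes "0 < \<kappa>" "\<kappa> < 1"
  shows "(1 - \<kappa>\<^sup>2) * (snd Y - phi \<kappa> x Y Z) - \<kappa> * cost \<kappa> Z Y
    = sqrt ((cost \<kappa> Z Y)\<^sup>2 - (1 - \<kappa>\<^sup>2) * (norm (x - fst Y))\<^sup>2)"
proof -
  define k where "k = 1 - \<kappa>\<^sup>2"
  have k: "k > 0" using assms by (simp add: k_def power_less_one_iff)
  define c where "c = cost \<kappa> Z Y"
  define r where "r = norm (x - fst Y)"
  have "c\<^sup>2 / k\<^sup>2 - r\<^sup>2 / k = (c\<^sup>2 - k * r\<^sup>2) / k\<^sup>2"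
    using k by (simp add: field_simps power2_eq_square)
  then have "sqrt (c\<^sup>2 / k\<^sup>2 - r\<^sup>2 / k) = sqrt (c\<^sup>2 - k * r\<^sup>2) / k"
    using k by (simp add: real_sqrt_divide)
  then have "phi \<kappa> x Y Z = snd Y - \<kappa> * c / k - sqrt (c\<^sup>2 - k * r\<^sup>2) / k"
    by (simp add: phi_def c_def r_def k_def)
  then have "k * (snd Y - phi \<kappa> x Y Z) - \<kappa> * c = sqrt (c\<^sup>2 - k * r\<^sup>2)"
    using k by (simp add: right_diff_distrib distrib_left)
  then show ?thesis by (simp add: c_def r_def k_def)
qed

lemma phi_self:
  assumes "0 < \<kappa>" "\<kappa> < 1" "axial \<kappa> Z Y \<ge> 0"
  shows "phi \<kappa> (fst Z) Y Z = snd Z"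
proof -
  have k: "1 - \<kappa>\<^sup>2 > 0" using assms by (simp add: power_less_one_iff)
  have "(1 - \<kappa>\<^sup>2) * (snd Y - phi \<kappa> (fst Z) Y Z) - \<kappa> * cost \<kappa> Z Y
      = (1 - \<kappa>\<^sup>2) * (snd Y - snd Z) - \<kappa> * cost \<kappa> Z Y"
    using phi_eq[OF assms(1,2), of Y "fst Z" Z] assms(3)
    by (simp flip: axial_sq) (simp add: axial_eq)
  then show ?thesis using k by simp
qed

text \<open>The graph of \<open>phi\<close> lies on the level set of the cost that contains \<open>Z\<close>.\<close>

lemma cost_phi:
  assumes "0 < \<kappa>" "\<kappa> < 1" and c: "(1 - \<kappa>\<^sup>2) * (norm (x - fst Y))\<^sup>2 \<le> (cost \<kappa> Z Y)\<^sup>2"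
  shows "cost \<kappa> (x, phi \<kappa> x Y Z) Y = cost \<kappa> Z Y"
proof -
  define k where "k = 1 - \<kappa>\<^sup>2"
  have k: "k > 0" using assms by (simp add: k_def power_less_one_iff)
  define c where "c = cost \<kappa> Z Y"
  define r where "r = norm (x - fst Y)"
  define b where "b = snd Y - phi \<kappa> x Y Z"
  have c0: "c \<ge> 0" using cost_ge[of \<kappa> Z Y] assms unfolding c_def
    by (smt (verit) mult_nonneg_nonneg norm_ge_zero)
  have e: "k * b - \<kappa> * c = sqrt (c\<^sup>2 - k * r\<^sup>2)"
    using phi_eq[OF assms(1,2), of Y x Z] by (simp add: k_def c_def r_def b_def)
  then have "k * b - \<kappa> * c \<ge> 0" using c by (simp add: k_def c_def r_def)
  then have "k * b \<ge> 0" using c0 assms by (smt (verit) mult_nonneg_nonneg)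
  then have b0: "b \<ge> 0" using k by (simp add: zero_le_mult_iff)
  have "(k * b - \<kappa> * c)\<^sup>2 = c\<^sup>2 - k * r\<^sup>2" using e c by (simp add: k_def c_def r_def)
  then have "k * (k * b\<^sup>2 - 2 * \<kappa> * b * c) + \<kappa>\<^sup>2 * c\<^sup>2 = c\<^sup>2 - k * r\<^sup>2"
    by (simp add: algebra_simps power2_eq_square)
  moreover have k2: "\<kappa>\<^sup>2 = 1 - k" by (simp add: k_def)
  ultimately have "k * (k * b\<^sup>2 - 2 * \<kappa> * b * c) = k * (c\<^sup>2 - r\<^sup>2)" by (simp add: algebra_simps)
  then have "k * b\<^sup>2 - 2 * \<kappa> * b * c = c\<^sup>2 - r\<^sup>2" using k by simp
  moreover have "(c + \<kappa> * b)\<^sup>2 = c\<^sup>2 + 2 * \<kappa> * b * c + \<kappa>\<^sup>2 * b\<^sup>2"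
    by (simp add: algebra_simps power2_eq_square)
  ultimately have "r\<^sup>2 + b\<^sup>2 = (c + \<kappa> * b)\<^sup>2"
    using k2 by (simp add: algebra_simps)
  moreover have "(norm ((x, phi \<kappa> x Y Z) - Y))\<^sup>2 = r\<^sup>2 + b\<^sup>2"
    by (simp add: norm_point_sq r_def b_def power2_commute)
  ultimately have "norm ((x, phi \<kappa> x Y Z) - Y) = c + \<kappa> * b"
    using c0 b0 assms by (simp add: power2_eq_iff_nonneg)
  then show ?thesis by (simp add: cost_def b_def algebra_simps c_def)
qed

text \<open>
  \<open>Lam\<close> inverts Snell's law: the direction in which a focus is seen from
  \<open>Z\<close> is determined by the slope of its ellipsoid, and conversely
  (\<open>steepness_Lam\<close>).
\<close>

lemma Lam_steepness:
  assumes "0 < \<kappa>" "\<kappa> < 1" and T: "axial \<kappa> Z Y > 0"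
  shows "Y = Z + norm (Z - Y) *\<^sub>R Lam \<kappa> (steepness \<kappa> Z Y)"
proof -
  define R where "R = norm (Z - Y)"
  define T where "T = axial \<kappa> Z Y"
  define b where "b = snd Y - snd Z"
  define r where "r = norm (fst Z - fst Y)"
  define c where "c = cost \<kappa> Z Y"
  define k where "k = 1 - \<kappa>\<^sup>2"
  have T0: "T > 0" using T by (simp add: T_def)
  have Tb: "T = b - \<kappa> * R" by (simp add: T_def b_def R_def axial_def)
  have cR: "c = R - \<kappa> * b" by (simp add: c_def b_def R_def cost_def algebra_simps)
  have R2: "R\<^sup>2 = r\<^sup>2 + b\<^sup>2" by (simp add: R_def r_def b_def norm_point_sq power2_commute)
  have R0: "R > 0"
  proof (rule ccontr)
    assume "\<not> R > 0"
    then have "R = 0" by (simp add: R_def)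
    then have "Z = Y" by (simp add: R_def)
    then show False using T0 by (simp add: T_def axial_def)
  qed
  have c0: "c \<ge> 0" using cost_ge[of \<kappa> Z Y] assms unfolding c_def
    by (smt (verit) mult_nonneg_nonneg norm_ge_zero)
  have T2: "T\<^sup>2 = c\<^sup>2 - k * r\<^sup>2" using axial_sq[of \<kappa> Z Y] by (simp add: T_def c_def k_def r_def)
  have nv: "(norm (steepness \<kappa> Z Y))\<^sup>2 = r\<^sup>2 / T\<^sup>2"
    using T0 by (simp add: steepness_def r_def T_def[symmetric] power_divide)
  have "1 + k * (r\<^sup>2 / T\<^sup>2) = (c / T)\<^sup>2" using T2 T0 by (simp add: field_simps power_divide)
  then have "sqrt (1 + k * (r\<^sup>2 / T\<^sup>2)) = c / T" using T0 c0 by simp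
  then have "Q \<kappa> (steepness \<kappa> Z Y) = (c / T - \<kappa>) / (1 + r\<^sup>2 / T\<^sup>2)"
    by (simp add: Q_def nv k_def)
  also have "\<dots> = ((c / T - \<kappa>) * T\<^sup>2) / ((1 + r\<^sup>2 / T\<^sup>2) * T\<^sup>2)"
    using T0 by simp
  also have "(c / T - \<kappa>) * T\<^sup>2 = T * (c - \<kappa> * T)"
    using T0 by (simp add: field_simps power2_eq_square)
  also have "(1 + r\<^sup>2 / T\<^sup>2) * T\<^sup>2 = T\<^sup>2 + r\<^sup>2"
    using T0 by (simp add: field_simps)
  also have "T\<^sup>2 + r\<^sup>2 = R * (c - \<kappa> * T)"
  proof -
    have "r\<^sup>2 = R\<^sup>2 - b\<^sup>2" using R2 by simp
    then show ?thesis unfolding cR Tb by (simp add: algebra_simps power2_eq_square)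
  qed
  also have "T * (c - \<kappa> * T) / (R * (c - \<kappa> * T)) = T / R"
  proof -
    have "T\<^sup>2 + r\<^sup>2 > 0" using T0 by (simp add: add_pos_nonneg)
    then have "c - \<kappa> * T \<noteq> 0" using \<open>T\<^sup>2 + r\<^sup>2 = R * (c - \<kappa> * T)\<close> by auto
    then show ?thesis by simp
  qed
  finally have Q: "Q \<kappa> (steepness \<kappa> Z Y) = T / R" .
  have "R *\<^sub>R Lam \<kappa> (steepness \<kappa> Z Y) = (fst Y - fst Z, T + \<kappa> * R)"
  proof -
    have "Lam \<kappa> (steepness \<kappa> Z Y) = ((1 / R) *\<^sub>R (fst Y - fst Z), T / R + \<kappa>)"
      using T0 unfolding Lam_def Q by (simp add: steepness_def T_def[symmetric] algebra_simps)
    then show ?thesis using R0 by (simp add: distrib_left)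
  qed
  also have "\<dots> = Y - Z" by (simp add: Tb b_def prod_eq_iff)
  finally show ?thesis by (simp add: R_def)
qed

lemma Q_pos: "0 < \<kappa> \<Longrightarrow> \<kappa> < 1 \<Longrightarrow> Q \<kappa> v > 0"
proof -
  assume "0 < \<kappa>" "\<kappa> < 1"
  then have "1 - \<kappa>\<^sup>2 \<ge> 0" by (simp add: power_le_one)
  then have "sqrt (1 + (1 - \<kappa>\<^sup>2) * (norm v)\<^sup>2) \<ge> 1" by simp
  then have "sqrt (1 + (1 - \<kappa>\<^sup>2) * (norm v)\<^sup>2) - \<kappa> > 0" using \<open>\<kappa> < 1\<close> by linarith
  then show ?thesis unfolding Q_def by (intro divide_pos_pos) (simp_all add: add_pos_nonneg)
qed

lemma norm_Lam:
  assumes "0 < \<kappa>" "\<kappa> < 1"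
  shows "norm (Lam \<kappa> v) = 1"
proof -
  define a where "a = sqrt (1 + (1 - \<kappa>\<^sup>2) * (norm v)\<^sup>2)"
  define p where "p = 1 + (norm v)\<^sup>2"
  have p: "p > 0" by (simp add: p_def add_pos_nonneg)
  have k: "1 - \<kappa>\<^sup>2 \<ge> 0" using assms by (simp add: power_le_one)
  have "a\<^sup>2 = 1 + (1 - \<kappa>\<^sup>2) * (norm v)\<^sup>2" using k by (simp add: a_def)
  then have a2: "a\<^sup>2 - \<kappa>\<^sup>2 = (1 - \<kappa>\<^sup>2) * p" by (simp add: p_def algebra_simps)
  have q: "Q \<kappa> v * p = a - \<kappa>" using p by (simp add: Q_def a_def p_def)
  have "(norm (Lam \<kappa> v))\<^sup>2 = (Q \<kappa> v)\<^sup>2 * p + 2 * \<kappa> * Q \<kappa> v + \<kappa>\<^sup>2"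
    by (simp add: norm_point_sq Lam_def p_def power_mult_distrib) (simp add: algebra_simps power2_eq_square)
  then have "(norm (Lam \<kappa> v))\<^sup>2 * p = (Q \<kappa> v * p)\<^sup>2 + 2 * \<kappa> * (Q \<kappa> v * p) + \<kappa>\<^sup>2 * p"
    by (simp add: algebra_simps power2_eq_square)
  also have "\<dots> = p" using a2 unfolding q by (simp add: algebra_simps power2_eq_square)
  finally have "(norm (Lam \<kappa> v))\<^sup>2 = 1" using p by simp
  then show ?thesis using power2_eq_iff_nonneg[of "norm (Lam \<kappa> v)" 1] by simp
qed

lemma steepness_Lam:
  assumes "0 < \<kappa>" "\<kappa> < 1" "r > 0"
  shows "steepness \<kappa> Z (Z + r *\<^sub>R Lam \<kappa> v) = v"
proof -
  have "axial \<kappa> Z (Z + r *\<^sub>R Lam \<kappa> v) = r * Q \<kappa> v"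
    using assms by (simp add: axial_def norm_Lam) (simp add: Lam_def algebra_simps)
  then show ?thesis using assms Q_pos[OF assms(1,2), of v]
    by (simp add: steepness_def Lam_def)
qed

section \<open>Uniform bounds over the target\<close>

lemma fst_le_norm: "norm (fst X) \<le> norm (X :: 'n::finite point)"
  using norm_fst_le[of "fst X" "snd X"] by simp

lemma GDERIV_of_powr_bound:
  fixes f :: "'a::real_inner \<Rightarrow> real"
  assumes U: "open U" "z \<in> U" and p: "0 < p" and K: "0 \<le> K"
    and b: "\<And>x. x \<in> U \<Longrightarrow> \<bar>f x - f z - v \<bullet> (x - z)\<bar> \<le> K * norm (x - z) powr (1 + p)"
  shows "GDERIV f z :> v"
proof -
  have "((\<lambda>y. inverse (norm (y - z)) * (f y - f z - v \<bullet> (y - z))) \<longlongrightarrow> 0) (at z)"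
  proof (rule Lim_null_comparison)
    have "((\<lambda>y. norm (y - z)) \<longlongrightarrow> norm (z - z)) (at z)" by (intro tendsto_intros)
    then have "((\<lambda>y. norm (y - z) powr p) \<longlongrightarrow> 0) (at z)"
      using tendsto_powr'[of "\<lambda>y. norm (y - z)" 0 "at z" "\<lambda>_. p" p] p by auto
    from tendsto_mult_left[OF this, of K] show "((\<lambda>y. K * norm (y - z) powr p) \<longlongrightarrow> 0) (at z)" by simp
    have "\<forall>\<^sub>F y in at z. y \<in> U" using U by (simp add: eventually_at_in_open')
    moreover have "\<forall>\<^sub>F y in at z. y \<noteq> z" by (simp add: eventually_at_filter)
    ultimately show "\<forall>\<^sub>F y in at z. norm (inverse (norm (y - z)) * (f y - f z - v \<bullet> (y - z)))
        \<le> K * norm (y - z) powr p"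
    proof eventually_elim
      case (elim y)
      then have n: "norm (y - z) > 0" by simp
      have "norm (inverse (norm (y - z)) * (f y - f z - v \<bullet> (y - z)))
          \<le> inverse (norm (y - z)) * (K * norm (y - z) powr (1 + p))"
        using b[OF elim(1)] n by (simp add: abs_mult)
      also have "\<dots> = K * norm (y - z) powr p" using n by (simp add: powr_add)
      finally show ?case .
    qed
  qed
  moreover have "(\<lambda>y. (1 / norm (y - z)) *\<^sub>R (f y - (f z + (y - z) \<bullet> v)))
      = (\<lambda>y. inverse (norm (y - z)) * (f y - f z - v \<bullet> (y - z)))"
    by (simp add: fun_eq_iff inverse_eq_divide inner_commute diff_diff_eq)
  ultimately show ?thesis unfolding gderiv_def has_derivative_at2
    by (simp add: bounded_linear_inner_left)
qed

locale refraction_domain =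
  fixes \<kappa> M0 \<delta>0 :: real and \<Omega> :: "(real^'n::finite) set"
  assumes kappa: "0 < \<kappa>" "\<kappa> < 1" and M0_pos: "0 < M0" and delta0: "0 < \<delta>0" "\<delta>0 < 1"
    and open_Omega: "open \<Omega>" and Omega_nonempty: "\<Omega> \<noteq> {}"
begin

text \<open>
  With \<open>theta\<close> one has \<open>theta * c \<le> axial \<le> c\<close>, and
  \<open>Vmax\<close> bounds all slopes. The set \<open>slab e\<close> keeps a distance
  \<open>e\<close> below the top of the cylinder, hence below the target; there \<open>axial\<close>
  is at least \<open>axial_min e\<close>. All constants that depend on the position of the base
  point are functions of \<open>e\<close> alone.
\<close>

definition theta :: real where "theta = sqrt (1 - \<delta>0\<^sup>2)"
definition Vmax :: real where "Vmax = \<delta>0 / (sqrt (1 - \<kappa>\<^sup>2) * theta)"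
definition slab :: "real \<Rightarrow> 'n point set" where "slab e = \<Omega> \<times> {0..M0 - e}"
definition axial_min :: "real \<Rightarrow> real" where "axial_min e = theta * (1 - \<kappa>) * e"

abbreviation \<T> where "\<T> \<equiv> targets \<kappa> M0 \<delta>0 \<Omega>"

lemma k_pos: "0 < 1 - \<kappa>\<^sup>2" and k_le: "1 - \<kappa>\<^sup>2 \<le> 1"
  using kappa by (simp_all add: power_less_one_iff)

lemma theta_pos: "0 < theta" and theta_sq: "theta\<^sup>2 = 1 - \<delta>0\<^sup>2"
  using delta0 by (simp_all add: theta_def power_less_one_iff power_le_one)

lemma Vmax_pos: "0 < Vmax"
  using delta0 theta_pos k_pos by (simp add: Vmax_def)

lemma axial_min_pos: "0 < e \<Longrightarrow> 0 < axial_min e"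
  using theta_pos kappa by (simp add: axial_min_def)

lemma cost_nonneg: "0 \<le> cost \<kappa> X Y"
  using cost_ge[OF kappa(1), of X Y] kappa by (smt (verit) mult_nonneg_nonneg norm_ge_zero)

lemma slab_mono: "e' \<le> e \<Longrightarrow> slab e \<subseteq> slab e'"
  by (auto simp: slab_def)

text \<open>
  A refractor may touch the heights \<open>0\<close> and \<open>M0\<close>, which the open cylinder
  misses. The conditions on the target pass to the limit in the height, with non-strict
  inequalities.
\<close>

lemma target_closed:
  assumes Y: "Y \<in> \<T>" and Z: "Z \<in> slab 0"
  shows "\<kappa> * cost \<kappa> Z Y \<le> (1 - \<kappa>\<^sup>2) * (snd Y - snd Z)"
    and "x \<in> \<Omega> \<Longrightarrow> sqrt (1 - \<kappa>\<^sup>2) * norm (x - fst Y) \<le> \<delta>0 * cost \<kappa> Z Y"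
proof -
  have z: "fst Z \<in> \<Omega>" "snd Z \<in> {0..M0}" using Z by (auto simp: slab_def)
  have clo: "snd Z \<in> closure {0<..<M0}" using z M0_pos by (simp add: closure_greaterThanLessThan)
  have cont: "continuous_on UNIV (\<lambda>h. cost \<kappa> (fst Z, h) Y)"
    unfolding cost_def by (intro continuous_intros)
  have t: "h \<le> snd Y - \<kappa> * cost \<kappa> (fst Z, h) Y / (1 - \<kappa>\<^sup>2)"
      "\<Omega> \<subseteq> ball (fst Y) (\<delta>0 * cost \<kappa> (fst Z, h) Y / sqrt (1 - \<kappa>\<^sup>2))" if "h \<in> {0<..<M0}" for h
    using Y z that unfolding targets_def cyl_def by force+
  have "closed {h. \<kappa> * cost \<kappa> (fst Z, h) Y \<le> (1 - \<kappa>\<^sup>2) * (snd Y - h)}"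
    by (intro closed_Collect_le continuous_intros cont)
  moreover have "{0<..<M0} \<subseteq> {h. \<kappa> * cost \<kappa> (fst Z, h) Y \<le> (1 - \<kappa>\<^sup>2) * (snd Y - h)}"
    using t(1) k_pos by (auto simp: field_simps)
  ultimately have "closure {0<..<M0} \<subseteq> {h. \<kappa> * cost \<kappa> (fst Z, h) Y \<le> (1 - \<kappa>\<^sup>2) * (snd Y - h)}"
    by (rule closure_minimal[rotated])
  then show "\<kappa> * cost \<kappa> Z Y \<le> (1 - \<kappa>\<^sup>2) * (snd Y - snd Z)" using clo by auto
  assume x: "x \<in> \<Omega>"
  have "closed {h. sqrt (1 - \<kappa>\<^sup>2) * norm (x - fst Y) \<le> \<delta>0 * cost \<kappa> (fst Z, h) Y}"
    by (intro closed_Collect_le continuous_intros cont)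
  moreover have "{0<..<M0} \<subseteq> {h. sqrt (1 - \<kappa>\<^sup>2) * norm (x - fst Y) \<le> \<delta>0 * cost \<kappa> (fst Z, h) Y}"
  proof
    fix h assume "h \<in> {0<..<M0}"
    then have "norm (x - fst Y) < \<delta>0 * cost \<kappa> (fst Z, h) Y / sqrt (1 - \<kappa>\<^sup>2)"
      using t(2)[of h] x by (auto simp: dist_norm norm_minus_commute)
    then show "h \<in> {h. sqrt (1 - \<kappa>\<^sup>2) * norm (x - fst Y) \<le> \<delta>0 * cost \<kappa> (fst Z, h) Y}"
      using k_pos by (simp add: pos_less_divide_eq mult.commute)
  qed
  ultimately have "closure {0<..<M0} \<subseteq> {h. sqrt (1 - \<kappa>\<^sup>2) * norm (x - fst Y) \<le> \<delta>0 * cost \<kappa> (fst Z, h) Y}"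
    by (rule closure_minimal[rotated])
  then show "sqrt (1 - \<kappa>\<^sup>2) * norm (x - fst Y) \<le> \<delta>0 * cost \<kappa> Z Y" using clo by auto
qed

lemma target_above:
  assumes Y: "Y \<in> \<T>"
  shows "M0 \<le> snd Y"
proof -
  obtain x where x: "x \<in> \<Omega>" using Omega_nonempty by blast
  have "\<kappa> * cost \<kappa> (x, M0) Y \<le> (1 - \<kappa>\<^sup>2) * (snd Y - M0)"
    using target_closed(1)[OF Y, of "(x, M0)"] x M0_pos by (simp add: slab_def)
  moreover have "0 \<le> \<kappa> * cost \<kappa> (x, M0) Y" using cost_nonneg[of "(x, M0)" Y] kappa by simp
  ultimately have "0 \<le> (1 - \<kappa>\<^sup>2) * (snd Y - M0)" by linarith
  then show ?thesis using k_pos by (simp add: zero_le_mult_iff)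
qed

lemma discriminant_ge:
  assumes Y: "Y \<in> \<T>" and Z: "Z \<in> slab 0" and x: "x \<in> \<Omega>"
  shows "(theta * cost \<kappa> Z Y)\<^sup>2 \<le> (cost \<kappa> Z Y)\<^sup>2 - (1 - \<kappa>\<^sup>2) * (norm (x - fst Y))\<^sup>2"
proof -
  have "(sqrt (1 - \<kappa>\<^sup>2) * norm (x - fst Y))\<^sup>2 \<le> (\<delta>0 * cost \<kappa> Z Y)\<^sup>2"
    using target_closed(2)[OF Y Z x] k_pos by (intro power_mono) auto
  then have "(1 - \<kappa>\<^sup>2) * (norm (x - fst Y))\<^sup>2 \<le> \<delta>0\<^sup>2 * (cost \<kappa> Z Y)\<^sup>2"
    using k_pos by (simp add: power_mult_distrib)
  then show ?thesis by (simp add: power_mult_distrib theta_sq left_diff_distrib)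
qed

lemma axial_ge:
  assumes Y: "Y \<in> \<T>" and Z: "Z \<in> slab 0"
  shows "theta * cost \<kappa> Z Y \<le> axial \<kappa> Z Y"
proof -
  have "fst Z \<in> \<Omega>" using Z by (auto simp: slab_def)
  then have "(theta * cost \<kappa> Z Y)\<^sup>2 \<le> (axial \<kappa> Z Y)\<^sup>2"
    using discriminant_ge[OF Y Z] by (simp add: axial_sq)
  moreover have "0 \<le> axial \<kappa> Z Y" using target_closed(1)[OF Y Z] by (simp add: axial_eq)
  ultimately show ?thesis by (rule power2_le_imp_le)
qed

text \<open>If the cost vanished at one point of the slab, all of \<open>\<Omega>\<close> would be the single point \<open>fst Y\<close>.\<close>

lemma cost_pos:
  assumes Y: "Y \<in> \<T>" and Z: "Z \<in> slab 0"
  shows "0 < cost \<kappa> Z Y"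
proof (rule ccontr)
  assume "\<not> 0 < cost \<kappa> Z Y"
  then have "cost \<kappa> Z Y = 0" using cost_nonneg[of Z Y] by simp
  then have "x = fst Y" if "x \<in> \<Omega>" for x
    using target_closed(2)[OF Y Z that] k_pos by (simp add: mult_le_0_iff)
  then have "\<Omega> = {fst Y}" using Omega_nonempty by blast
  then show False using open_Omega not_open_singleton by metis
qed

lemma axial_pos:
  assumes "Y \<in> \<T>" and "Z \<in> slab 0"
  shows "0 < axial \<kappa> Z Y"
  using axial_ge[OF assms] cost_pos[OF assms] theta_pos by (smt (verit) mult_pos_pos)

lemma cost_lower:
  assumes Y: "Y \<in> \<T>" and Z: "Z \<in> slab e"
  shows "(1 - \<kappa>) * e \<le> cost \<kappa> Z Y"
proof -
  have "e \<le> snd Y - snd Z" using target_above[OF Y] Z by (auto simp: slab_def)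
  also have "\<dots> \<le> norm (Z - Y)" using snd_le_norm[of "Z - Y"] by simp
  finally have "(1 - \<kappa>) * e \<le> (1 - \<kappa>) * norm (Z - Y)" using kappa by simp
  then show ?thesis using cost_ge[OF kappa(1), of Z Y] by linarith
qed

lemma axial_lower:
  assumes Y: "Y \<in> \<T>" and Z: "Z \<in> slab e" and e: "0 \<le> e"
  shows "axial_min e \<le> axial \<kappa> Z Y"
proof -
  have "theta * ((1 - \<kappa>) * e) \<le> theta * cost \<kappa> Z Y"
    using cost_lower[OF Y Z] theta_pos by simp
  also have "\<dots> \<le> axial \<kappa> Z Y" using slab_mono[OF e] Z by (intro axial_ge[OF Y]) auto
  finally show ?thesis by (simp add: axial_min_def mult.assoc)
qed

lemma inv_axial_le:
  assumes "Y \<in> \<T>" "Z \<in> slab e" "0 < e"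
  shows "1 / axial \<kappa> Z Y \<le> 1 / axial_min e"
  using axial_lower[OF assms(1,2)] axial_min_pos[OF assms(3)] assms(3)
  by (simp add: frac_le)

lemma norm_over_discriminant:
  assumes Y: "Y \<in> \<T>" and Z: "Z \<in> slab 0" and x: "x \<in> \<Omega>"
  shows "norm (x - fst Y) \<le> Vmax * (theta * cost \<kappa> Z Y)"
  using target_closed(2)[OF Y Z x] k_pos theta_pos by (simp add: Vmax_def field_simps)

lemma steepness_le:
  assumes Y: "Y \<in> \<T>" and Z: "Z \<in> slab 0"
  shows "norm (steepness \<kappa> Z Y) \<le> Vmax"
proof -
  have "fst Z \<in> \<Omega>" using Z by (auto simp: slab_def)
  then have "norm (fst Z - fst Y) \<le> Vmax * (theta * cost \<kappa> Z Y)"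
    by (rule norm_over_discriminant[OF Y Z])
  also have "\<dots> \<le> Vmax * axial \<kappa> Z Y"
    using axial_ge[OF Y Z] Vmax_pos by simp
  finally have "norm (fst Z - fst Y) \<le> Vmax * axial \<kappa> Z Y" .
  then show ?thesis using axial_pos[OF Y Z] by (simp add: steepness_def divide_le_eq)
qed

lemma cost_phi_target:
  assumes Y: "Y \<in> \<T>" and Z: "Z \<in> slab 0" and x: "x \<in> \<Omega>"
  shows "cost \<kappa> (x, phi \<kappa> x Y Z) Y = cost \<kappa> Z Y"
proof (rule cost_phi[OF kappa])
  show "(1 - \<kappa>\<^sup>2) * (norm (x - fst Y))\<^sup>2 \<le> (cost \<kappa> Z Y)\<^sup>2"
    using discriminant_ge[OF Y Z x] zero_le_power2[of "theta * cost \<kappa> Z Y"] by linarith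
qed

lemma phi_base:
  assumes "Y \<in> \<T>" and "Z \<in> slab 0"
  shows "phi \<kappa> (fst Z) Y Z = snd Z"
  using axial_pos[OF assms] by (intro phi_self kappa) simp

text \<open>
  Lying below the lower half of an ellipsoid is the same as lying outside of it: a point of the slab
  cannot lie above the upper half, since the defining inequality of the target, applied at that
  point, puts it below the centre of its own ellipsoid, and smaller ellipsoids with the same focus
  have higher centres.
\<close>

lemma le_phi_iff:
  assumes Y: "Y \<in> \<T>" and Z: "Z \<in> slab 0" and X: "X \<in> slab 0"
  shows "snd X \<le> phi \<kappa> (fst X) Y Z \<longleftrightarrow> cost \<kappa> Z Y \<le> cost \<kappa> X Y"
proof -
  define k where "k = 1 - \<kappa>\<^sup>2"
  have k: "k > 0" using k_pos by (simp add: k_def)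
  define b where "b = snd Y - snd X"
  define r where "r = norm (fst X - fst Y)"
  define c0 where "c0 = cost \<kappa> Z Y"
  define c1 where "c1 = cost \<kappa> X Y"
  define S where "S = sqrt (c0\<^sup>2 - k * r\<^sup>2)"
  have x: "fst X \<in> \<Omega>" using X by (auto simp: slab_def)
  have c0: "c0 > 0" and c1: "c1 > 0" using cost_pos Y Z X by (auto simp: c0_def c1_def)
  have kb: "\<kappa> * c1 \<le> k * b" using target_closed(1)[OF Y X] by (simp add: c1_def k_def b_def)
  then have b0: "b \<ge> 0"
    using c1 kappa k by (smt (verit) mult_pos_pos mult_pos_neg)
  have disc: "c0\<^sup>2 - k * r\<^sup>2 \<ge> 0"
    using discriminant_ge[OF Y Z x] zero_le_power2[of "theta * cost \<kappa> Z Y"]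
    unfolding c0_def k_def r_def by linarith
  have "k * b\<^sup>2 - 2 * \<kappa> * b * c1 = c1\<^sup>2 - r\<^sup>2"
    using cost_quadratic[of \<kappa> Y X] by (simp add: b_def c1_def k_def r_def)
  moreover have "(k * b - \<kappa> * c0)\<^sup>2 - (c0\<^sup>2 - k * r\<^sup>2)
     = k * (k * b\<^sup>2 - 2 * \<kappa> * b * c1 - (c1\<^sup>2 - r\<^sup>2) + (c1 - c0) * (2 * \<kappa> * b + c1 + c0))
       + (\<kappa>\<^sup>2 + k - 1) * c0\<^sup>2"
    by (simp add: algebra_simps power2_eq_square)
  ultimately have key: "(k * b - \<kappa> * c0)\<^sup>2 - (c0\<^sup>2 - k * r\<^sup>2) = k * ((c1 - c0) * (2 * \<kappa> * b + c1 + c0))"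
    by (simp add: k_def)
  have pos: "2 * \<kappa> * b + c1 + c0 > 0" using b0 c0 c1 kappa
    by (intro add_nonneg_pos add_nonneg_nonneg mult_nonneg_nonneg) auto
  have "k * (snd Y - phi \<kappa> (fst X) Y Z) - \<kappa> * c0 = S"
    using phi_eq[OF kappa, of Y "fst X" Z] by (simp add: k_def c0_def S_def r_def)
  then have "k * (phi \<kappa> (fst X) Y Z - snd X) = (k * b - \<kappa> * c0) - S"
    by (simp add: b_def algebra_simps)
  then have "snd X \<le> phi \<kappa> (fst X) Y Z \<longleftrightarrow> S \<le> k * b - \<kappa> * c0"
    using k by (smt (verit) zero_le_mult_iff)
  also have "\<dots> \<longleftrightarrow> c0 \<le> c1"
  proof
    assume S: "S \<le> k * b - \<kappa> * c0"
    have "S\<^sup>2 \<le> (k * b - \<kappa> * c0)\<^sup>2" using S disc by (intro power_mono) (auto simp: S_def)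
    then have "0 \<le> k * ((c1 - c0) * (2 * \<kappa> * b + c1 + c0))" using key disc by (simp add: S_def)
    then show "c0 \<le> c1" using k pos by (simp add: zero_le_mult_iff)
  next
    assume le: "c0 \<le> c1"
    then have "0 \<le> k * ((c1 - c0) * (2 * \<kappa> * b + c1 + c0))" using k pos by simp
    then have "c0\<^sup>2 - k * r\<^sup>2 \<le> (k * b - \<kappa> * c0)\<^sup>2" using key by linarith
    moreover have "\<kappa> * c0 \<le> k * b" using kb le kappa mult_left_mono[OF le, of \<kappa>] by linarith
    ultimately show "S \<le> k * b - \<kappa> * c0" unfolding S_def by (intro real_le_lsqrt) auto
  qed
  finally show ?thesis by (simp add: c0_def c1_def)
qed

text \<open>
  The bound is global in \<open>x\<close>, although \<open>\<Omega>\<close> need not be convex,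
  because it is obtained from a difference of square roots and not by integrating a gradient.
\<close>

lemma phi_lipschitz:
  assumes Y: "Y \<in> \<T>" and Z: "Z \<in> slab 0" and x: "x \<in> \<Omega>" and x': "x' \<in> \<Omega>"
  shows "\<bar>phi \<kappa> x Y Z - phi \<kappa> x' Y Z\<bar> \<le> Vmax * norm (x - x')"
proof -
  define k where "k = 1 - \<kappa>\<^sup>2"
  have k: "k > 0" using k_pos by (simp add: k_def)
  define c where "c = cost \<kappa> Z Y"
  define S where "S x = sqrt (c\<^sup>2 - k * (norm (x - fst Y))\<^sup>2)" for x
  have tc: "theta * c > 0" using cost_pos[OF Y Z] theta_pos by (simp add: c_def)
  have d: "(theta * c)\<^sup>2 \<le> c\<^sup>2 - k * (norm (x - fst Y))\<^sup>2" if "x \<in> \<Omega>" for x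
    using discriminant_ge[OF Y Z that] by (simp add: c_def k_def)
  have S2: "(S x)\<^sup>2 = c\<^sup>2 - k * (norm (x - fst Y))\<^sup>2" if "x \<in> \<Omega>" for x
    using d[OF that] zero_le_power2[of "theta * c"] unfolding S_def by (intro real_sqrt_pow2) linarith
  have Sge: "theta * c \<le> S x" if "x \<in> \<Omega>" for x
    unfolding S_def by (rule real_le_rsqrt[OF d[OF that]])
  have n: "norm (x - fst Y) \<le> Vmax * (theta * c)" if "x \<in> \<Omega>" for x
    using norm_over_discriminant[OF Y Z that] by (simp add: c_def)
  have "(S x' - S x) * (S x' + S x) = (S x')\<^sup>2 - (S x)\<^sup>2" by (simp add: algebra_simps power2_eq_square)
  also have "\<dots> = k * ((norm (x - fst Y) - norm (x' - fst Y)) * (norm (x - fst Y) + norm (x' - fst Y)))"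
    using S2[OF x] S2[OF x'] by (simp add: algebra_simps power2_eq_square)
  finally have "\<bar>(S x' - S x) * (S x' + S x)\<bar>
    = \<bar>k * ((norm (x - fst Y) - norm (x' - fst Y)) * (norm (x - fst Y) + norm (x' - fst Y)))\<bar>"
    by simp
  then have "\<bar>S x' - S x\<bar> * (S x' + S x)
     = k * (\<bar>norm (x - fst Y) - norm (x' - fst Y)\<bar> * (norm (x - fst Y) + norm (x' - fst Y)))"
    using Sge[OF x] Sge[OF x'] tc k by (simp add: abs_mult)
  also have "\<dots> \<le> k * (norm (x - x') * (2 * Vmax * (theta * c)))"
  proof (intro mult_left_mono mult_mono)
    show "\<bar>norm (x - fst Y) - norm (x' - fst Y)\<bar> \<le> norm (x - x')"
      using norm_triangle_ineq3[of "x - fst Y" "x' - fst Y"] by simp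
    show "norm (x - fst Y) + norm (x' - fst Y) \<le> 2 * Vmax * (theta * c)"
      using n[OF x] n[OF x'] by simp
  qed (use k in auto)
  finally have "\<bar>S x' - S x\<bar> * (S x' + S x) \<le> k * Vmax * norm (x - x') * (2 * (theta * c))"
    by (simp add: mult_ac)
  moreover have "\<bar>S x' - S x\<bar> * (2 * (theta * c)) \<le> \<bar>S x' - S x\<bar> * (S x' + S x)"
    using Sge[OF x] Sge[OF x'] by (intro mult_left_mono) auto
  ultimately have "\<bar>S x' - S x\<bar> * (2 * (theta * c)) \<le> k * Vmax * norm (x - x') * (2 * (theta * c))"
    by linarith
  then have SS: "\<bar>S x' - S x\<bar> \<le> k * (Vmax * norm (x - x'))"
    using tc mult_le_cancel_right_pos[of "2 * (theta * c)" "\<bar>S x' - S x\<bar>" "k * (Vmax * norm (x - x'))"]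
    by (simp add: mult.assoc)
  have "k * (snd Y - phi \<kappa> x Y Z) - \<kappa> * c = S x" for x
    using phi_eq[OF kappa, of Y x Z] by (simp add: k_def c_def S_def)
  from this[of x] this[of x'] have "k * (phi \<kappa> x Y Z - phi \<kappa> x' Y Z) = S x' - S x"
    by (simp add: algebra_simps)
  then have "k * \<bar>phi \<kappa> x Y Z - phi \<kappa> x' Y Z\<bar> = \<bar>S x' - S x\<bar>" using k
    by (metis abs_mult abs_of_pos)
  then have "k * \<bar>phi \<kappa> x Y Z - phi \<kappa> x' Y Z\<bar> \<le> k * (Vmax * norm (x - x'))" using SS by simp
  then show ?thesis using k by (rule mult_left_le_imp_le)
qed

lemma phi_excess:
  assumes Y: "Y \<in> \<T>" and Z: "Z \<in> slab 0" and x: "x \<in> \<Omega>"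
  shows "phi \<kappa> x Y Z - snd Z = steepness \<kappa> Z Y \<bullet> (x - fst Z)
     + 1 / axial \<kappa> Z Y * quad \<kappa> (x - fst Z, phi \<kappa> x Y Z - snd Z) / 2"
proof -
  have e: "(x, phi \<kappa> x Y Z) - Z = (x - fst Z, phi \<kappa> x Y Z - snd Z)" by (simp add: prod_eq_iff)
  have "excess \<kappa> Z Y ((x, phi \<kappa> x Y Z) - Z) = 0"
    using cost_excess[of \<kappa> Z Y "(x, phi \<kappa> x Y Z)"] axial_pos[OF Y Z] cost_phi_target[OF Y Z x]
    by simp
  then show ?thesis unfolding e by (simp add: excess_def)
qed

lemma quad_le:
  assumes "\<bar>snd W\<bar> \<le> Vmax * norm (fst W)"
  shows "quad \<kappa> W \<le> (1 + Vmax\<^sup>2) * (norm (fst W))\<^sup>2"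
proof -
  have "(snd W)\<^sup>2 \<le> (Vmax * norm (fst W))\<^sup>2"
    using assms Vmax_pos abs_le_square_iff[of "snd W" "Vmax * norm (fst W)"] by (simp add: abs_mult)
  moreover have "(1 - \<kappa>\<^sup>2) * (snd W)\<^sup>2 \<le> 1 * (snd W)\<^sup>2"
    using k_le by (intro mult_right_mono) auto
  ultimately have "quad \<kappa> W \<le> (norm (fst W))\<^sup>2 + (Vmax * norm (fst W))\<^sup>2"
    unfolding quad_def by linarith
  then show ?thesis by (simp add: distrib_right power_mult_distrib)
qed

lemma quad_ge: "(norm (fst W))\<^sup>2 \<le> quad \<kappa> W"
  using k_pos by (simp add: quad_def)

definition Cq :: "real \<Rightarrow> real" where "Cq e = (1 + Vmax\<^sup>2) / (2 * axial_min e)"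

lemma phi_expansion:
  assumes Y: "Y \<in> \<T>" and Z: "Z \<in> slab e" and e: "0 < e" and x: "x \<in> \<Omega>"
  shows "\<bar>phi \<kappa> x Y Z - snd Z - steepness \<kappa> Z Y \<bullet> (x - fst Z)\<bar> \<le> Cq e * (norm (x - fst Z))\<^sup>2"
proof -
  have Z0: "Z \<in> slab 0" using Z slab_mono[of 0 e] e by auto
  have z: "fst Z \<in> \<Omega>" using Z by (auto simp: slab_def)
  define W where "W = (x - fst Z, phi \<kappa> x Y Z - snd Z)"
  have "\<bar>snd W\<bar> \<le> Vmax * norm (fst W)"
    using phi_lipschitz[OF Y Z0 x z] phi_base[OF Y Z0] by (simp add: W_def)
  then have q: "quad \<kappa> W \<le> (1 + Vmax\<^sup>2) * (norm (fst W))\<^sup>2" by (rule quad_le)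
  have q0: "0 \<le> quad \<kappa> W" using quad_ge[of W] by (smt (verit) zero_le_power2)
  have "\<bar>1 / axial \<kappa> Z Y * quad \<kappa> W / 2\<bar> = 1 / axial \<kappa> Z Y * quad \<kappa> W / 2"
    using q0 axial_pos[OF Y Z0] by simp
  also have "\<dots> \<le> 1 / axial_min e * ((1 + Vmax\<^sup>2) * (norm (fst W))\<^sup>2) / 2"
    using inv_axial_le[OF Y Z e] q q0 axial_min_pos[OF e]
    by (intro divide_right_mono mult_mono) auto
  also have "\<dots> = Cq e * (norm (fst W))\<^sup>2" by (simp add: Cq_def)
  also have "1 / axial \<kappa> Z Y * quad \<kappa> W / 2 = phi \<kappa> x Y Z - snd Z - steepness \<kappa> Z Y \<bullet> (x - fst Z)"
    using phi_excess[OF Y Z0 x] by (simp add: W_def)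
  finally show ?thesis by (simp add: W_def)
qed

lemma slope_eq:
  assumes Y: "Y \<in> \<T>" and Z: "Z \<in> slab e" and e: "0 < e"
  shows "slope \<kappa> Z Y = steepness \<kappa> Z Y"
proof -
  have Z0: "Z \<in> slab 0" using Z slab_mono[of 0 e] e by auto
  have z: "fst Z \<in> \<Omega>" using Z by (auto simp: slab_def)
  have "GDERIV (\<lambda>x. phi \<kappa> x Y Z) (fst Z) :> steepness \<kappa> Z Y"
  proof (rule GDERIV_of_powr_bound[OF open_Omega z, of 1 "Cq e"])
    show "0 \<le> Cq e" using axial_min_pos[OF e] by (simp add: Cq_def)
    fix x assume "x \<in> \<Omega>"
    then show "\<bar>phi \<kappa> x Y Z - phi \<kappa> (fst Z) Y Z - steepness \<kappa> Z Y \<bullet> (x - fst Z)\<bar>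
        \<le> Cq e * norm (x - fst Z) powr (1 + 1)"
      using phi_expansion[OF Y Z e] phi_base[OF Y Z0] by (simp flip: powr_numeral)
  qed simp
  then show ?thesis unfolding slope_def by (rule gradient_eqI)
qed

definition Lip :: "real \<Rightarrow> real" where "Lip e = (1 + 2 * Vmax) / axial_min e + 2 / (axial_min e)\<^sup>2"

lemma Lip_pos: "0 < e \<Longrightarrow> 0 < Lip e"
  using axial_min_pos[of e] Vmax_pos by (simp add: Lip_def add_pos_pos)

lemma inv_axial_lipschitz:
  assumes Y: "Y \<in> \<T>" "Y' \<in> \<T>" and Z: "Z \<in> slab e" "Z' \<in> slab e" and e: "0 < e"
  shows "\<bar>1 / axial \<kappa> Z Y - 1 / axial \<kappa> Z' Y'\<bar> \<le> Lip e * (norm (Z - Z') + norm (Y - Y'))"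
proof -
  define m where "m = axial_min e"
  define D where "D = norm (Z - Z') + norm (Y - Y')"
  have m: "m > 0" "m \<le> axial \<kappa> Z Y" "m \<le> axial \<kappa> Z' Y'"
    using axial_min_pos[OF e] axial_lower Y Z e by (auto simp: m_def)
  have "\<bar>1 / axial \<kappa> Z Y - 1 / axial \<kappa> Z' Y'\<bar>
     = \<bar>axial \<kappa> Z' Y' - axial \<kappa> Z Y\<bar> / (axial \<kappa> Z Y * axial \<kappa> Z' Y')"
    using m by (simp add: divide_simps abs_mult)
  also have "\<dots> \<le> (2 * D) / (m * m)"
    using axial_lipschitz[OF kappa, of Z' Y' Z Y] m
    by (intro frac_le mult_mono) (auto simp: D_def norm_minus_commute)
  also have "\<dots> = 2 / m\<^sup>2 * D" by (simp add: power2_eq_square)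
  also have "\<dots> \<le> Lip e * D" unfolding Lip_def m_def[symmetric]
    using m Vmax_pos by (intro mult_right_mono) (auto simp: D_def)
  finally show ?thesis by (simp add: D_def)
qed

lemma steepness_lipschitz:
  assumes Y: "Y \<in> \<T>" "Y' \<in> \<T>" and Z: "Z \<in> slab e" "Z' \<in> slab e" and e: "0 < e"
  shows "norm (steepness \<kappa> Z Y - steepness \<kappa> Z' Y') \<le> Lip e * (norm (Z - Z') + norm (Y - Y'))"
proof -
  define m where "m = axial_min e"
  define D where "D = norm (Z - Z') + norm (Y - Y')"
  define t where "t = axial \<kappa> Z Y"
  define t' where "t' = axial \<kappa> Z' Y'"
  have Z0: "Z \<in> slab 0" "Z' \<in> slab 0" using Z slab_mono[of 0 e] e by auto
  have m: "m > 0" "m \<le> t" "m \<le> t'"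
    using axial_min_pos[OF e] axial_lower Y Z e by (auto simp: m_def t_def t'_def)
  have "steepness \<kappa> Z Y - steepness \<kappa> Z' Y'
     = (1 / t) *\<^sub>R ((fst (Z - Z') - fst (Y - Y')) + (t' - t) *\<^sub>R steepness \<kappa> Z' Y')"
  proof -
    have "t' *\<^sub>R steepness \<kappa> Z' Y' = fst Z' - fst Y'"
      using m by (simp add: steepness_def t'_def[symmetric])
    then have e: "(fst (Z - Z') - fst (Y - Y')) + (t' - t) *\<^sub>R steepness \<kappa> Z' Y'
        = (fst Z - fst Y) - t *\<^sub>R steepness \<kappa> Z' Y'"
      by (simp add: scaleR_diff_left)
    show ?thesis
      unfolding e using m by (simp add: steepness_def[of \<kappa> Z Y] t_def[symmetric] scaleR_diff_right)
  qed
  then have "norm (steepness \<kappa> Z Y - steepness \<kappa> Z' Y')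
     = (1 / t) * norm ((fst (Z - Z') - fst (Y - Y')) + (t' - t) *\<^sub>R steepness \<kappa> Z' Y')"
    using m by simp
  also have "\<dots> \<le> (1 / m) * (D + (2 * D) * Vmax)"
  proof (intro mult_mono)
    show "1 / t \<le> 1 / m" using m by (simp add: frac_le)
    have "norm (fst (Z - Z') - fst (Y - Y')) \<le> D"
      using norm_triangle_ineq4[of "fst (Z - Z')" "fst (Y - Y')"]
        fst_le_norm[of "Z - Z'"] fst_le_norm[of "Y - Y'"]
      by (simp add: D_def)
    moreover have "\<bar>t' - t\<bar> * norm (steepness \<kappa> Z' Y') \<le> (2 * D) * Vmax"
      using axial_lipschitz[OF kappa, of Z' Y' Z Y] steepness_le[OF Y(2) Z0(2)]
      by (intro mult_mono) (auto simp: D_def t_def t'_def norm_minus_commute)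
    ultimately show "norm ((fst (Z - Z') - fst (Y - Y')) + (t' - t) *\<^sub>R steepness \<kappa> Z' Y')
        \<le> D + (2 * D) * Vmax"
      by (intro order_trans[OF norm_triangle_ineq] add_mono) auto
  qed (use m in auto)
  also have "\<dots> = (1 + 2 * Vmax) / m * D" by (simp add: field_simps)
  also have "\<dots> \<le> Lip e * D" unfolding Lip_def m_def[symmetric]
    using m by (intro mult_right_mono) (auto simp: D_def)
  finally show ?thesis by (simp add: D_def)
qed

end

section \<open>Regularity as concavity of the curvature\<close>

context refraction_domain
begin

lemma cyl_slab: "Z \<in> cyl \<Omega> M0 \<Longrightarrow> Z \<in> slab (M0 - snd Z) \<and> 0 < M0 - snd Z"
  by (auto simp: cyl_def slab_def)

text \<open>
  Parabolas are needed rather than lines: the term \<open>h\<^sup>2 *\<^sub>R a\<close> contributes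
  at the same order as the curvature of the ellipsoid, so \<open>a\<close> can be used to balance
  the curvatures of two ellipsoids.
\<close>

lemma phi_second_order:
  assumes Y: "Y \<in> \<T>" and Z: "Z \<in> slab e" and e: "0 < e"
  shows "((\<lambda>h. (phi \<kappa> (fst Z + h *\<^sub>R w + h\<^sup>2 *\<^sub>R a) Y Z - snd Z - h * (steepness \<kappa> Z Y \<bullet> w)) / h\<^sup>2)
     \<longlongrightarrow> steepness \<kappa> Z Y \<bullet> a + 1 / axial \<kappa> Z Y * quad \<kappa> (w, steepness \<kappa> Z Y \<bullet> w) / 2) (at_right 0)"
proof -
  have Z0: "Z \<in> slab 0" using Z slab_mono[of 0 e] e by auto
  have z: "fst Z \<in> \<Omega>" using Z by (auto simp: slab_def)
  define v where "v = steepness \<kappa> Z Y"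
  define t where "t = 1 / axial \<kappa> Z Y"
  define x where "x h = fst Z + h *\<^sub>R w + h\<^sup>2 *\<^sub>R a" for h :: real
  define F where "F h = phi \<kappa> (x h) Y Z - snd Z" for h
  have px: "x h - fst Z = h *\<^sub>R (w + h *\<^sub>R a)" for h
    by (simp add: x_def algebra_simps power2_eq_square)
  have xlim: "(x \<longlongrightarrow> fst Z) (at_right 0)"
    unfolding x_def by (rule tendsto_eq_intros refl | simp)+
  have ev: "\<forall>\<^sub>F h in at_right 0. x h \<in> \<Omega>" using topological_tendstoD[OF xlim open_Omega z] .
  have pos: "\<forall>\<^sub>F h in at_right 0. 0 < (h::real)" by (simp add: eventually_at_right_less)
  have Fh: "((\<lambda>h. F h / h) \<longlongrightarrow> v \<bullet> w) (at_right 0)"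
  proof (rule Lim_transform)
    show "((\<lambda>h. v \<bullet> (w + h *\<^sub>R a)) \<longlongrightarrow> v \<bullet> w) (at_right 0)"
      by (rule tendsto_eq_intros refl | simp)+
    show "((\<lambda>h. F h / h - v \<bullet> (w + h *\<^sub>R a)) \<longlongrightarrow> 0) (at_right 0)"
    proof (rule Lim_null_comparison)
      show "((\<lambda>h. Cq e * (h * (norm (w + h *\<^sub>R a))\<^sup>2)) \<longlongrightarrow> 0) (at_right 0)"
        by (rule tendsto_eq_intros refl | simp)+
      show "\<forall>\<^sub>F h in at_right 0. norm (F h / h - v \<bullet> (w + h *\<^sub>R a))
          \<le> Cq e * (h * (norm (w + h *\<^sub>R a))\<^sup>2)"
        using ev pos
      proof eventually_elim
        case (elim h)
        have "\<bar>F h - h * (v \<bullet> (w + h *\<^sub>R a))\<bar> \<le> Cq e * (h * norm (w + h *\<^sub>R a))\<^sup>2"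
          using phi_expansion[OF Y Z e elim(1)] elim(2) by (simp add: px F_def v_def)
        then have "\<bar>F h - h * (v \<bullet> (w + h *\<^sub>R a))\<bar> / h \<le> Cq e * (h * norm (w + h *\<^sub>R a))\<^sup>2 / h"
          using elim(2) by (intro divide_right_mono) auto
        moreover have "F h / h - v \<bullet> (w + h *\<^sub>R a) = (F h - h * (v \<bullet> (w + h *\<^sub>R a))) / h"
          using elim(2) by (simp add: diff_divide_distrib)
        moreover have "Cq e * (h * norm (w + h *\<^sub>R a))\<^sup>2 / h = Cq e * (h * (norm (w + h *\<^sub>R a))\<^sup>2)"
          using elim(2) by (simp add: power2_eq_square)
        ultimately show ?case using elim(2) by (simp del: power_mult_distrib times_divide_eq_right)
      qed
    qed
  qed
  have "((\<lambda>h. v \<bullet> a + t * ((norm (w + h *\<^sub>R a))\<^sup>2 + (1 - \<kappa>\<^sup>2) * (F h / h)\<^sup>2) / 2)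
      \<longlongrightarrow> v \<bullet> a + t * quad \<kappa> (w, v \<bullet> w) / 2) (at_right 0)"
    unfolding quad_def by (rule tendsto_eq_intros Fh refl | simp)+
  moreover have "\<forall>\<^sub>F h in at_right 0. v \<bullet> a + t * ((norm (w + h *\<^sub>R a))\<^sup>2 + (1 - \<kappa>\<^sup>2) * (F h / h)\<^sup>2) / 2
      = (F h - h * (v \<bullet> w)) / h\<^sup>2"
    using ev pos
  proof eventually_elim
    case (elim h)
    have "F h = v \<bullet> (x h - fst Z) + t * quad \<kappa> (x h - fst Z, F h) / 2"
      using phi_excess[OF Y Z0 elim(1)] by (simp add: F_def v_def t_def)
    also have "v \<bullet> (x h - fst Z) = h * (v \<bullet> w) + h\<^sup>2 * (v \<bullet> a)"
      by (simp add: px inner_add_right power2_eq_square algebra_simps)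
    also have "quad \<kappa> (x h - fst Z, F h) = h\<^sup>2 * ((norm (w + h *\<^sub>R a))\<^sup>2 + (1 - \<kappa>\<^sup>2) * (F h / h)\<^sup>2)"
      using elim(2) by (simp add: quad_def px power_mult_distrib power_divide distrib_left)
    finally have "F h - h * (v \<bullet> w)
        = h\<^sup>2 * (v \<bullet> a + t * ((norm (w + h *\<^sub>R a))\<^sup>2 + (1 - \<kappa>\<^sup>2) * (F h / h)\<^sup>2) / 2)"
      by (simp add: algebra_simps)
    then show ?case using elim(2) by simp
  qed
  ultimately have "((\<lambda>h. (F h - h * (v \<bullet> w)) / h\<^sup>2)
      \<longlongrightarrow> v \<bullet> a + t * quad \<kappa> (w, v \<bullet> w) / 2) (at_right 0)"
    by (rule Lim_transform_eventually)
  then show ?thesis by (simp add: F_def x_def v_def t_def)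
qed

end

locale refraction_target = refraction_domain \<kappa> M0 \<delta>0 \<Omega>
  for \<kappa> M0 \<delta>0 :: real and \<Omega> :: "(real^'n::finite) set" +
  fixes \<S> :: "'n point set" and s :: "'n point \<Rightarrow> 'n point \<Rightarrow> real"
  assumes admissible: "admissible_target \<kappa> M0 \<delta>0 \<Omega> \<S> s"
begin

lemma target_subset: "\<S> \<subseteq> \<T>"
  using admissible hull_subset[of \<S> convex] unfolding admissible_target_def by blast

text \<open>
  \<open>Y_curve\<close> is the point at which a ray from \<open>Z\<close> meets the target, so its
  slope can be read off from the direction of the ray.
\<close>

lemma ray_meets_target:
  assumes "Y1 \<in> \<S>" "Y2 \<in> \<S>" "Z \<in> cyl \<Omega> M0" "l \<in> {0..1}"
  shows "\<S> \<inter> {Z + t *\<^sub>R dir_curve \<kappa> Z Y1 Y2 l | t. t > 0} = {Y_curve \<kappa> s Z Y1 Y2 l}"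
  using admissible assms unfolding admissible_target_def by blast

lemma target_slope:
  assumes "Y \<in> \<S>" "Z \<in> cyl \<Omega> M0"
  shows "slope \<kappa> Z Y = steepness \<kappa> Z Y"
  using slope_eq[of Y Z "M0 - snd Z"] cyl_slab[OF assms(2)] target_subset assms(1) by auto

lemma Y_curve_target:
  assumes "Y1 \<in> \<S>" "Y2 \<in> \<S>" "Z \<in> cyl \<Omega> M0" "l \<in> {0..1}"
  shows "Y_curve \<kappa> s Z Y1 Y2 l \<in> \<S>"
  using ray_meets_target[OF assms] by blast

lemma steepness_Y_curve:
  assumes "Y1 \<in> \<S>" "Y2 \<in> \<S>" "Z \<in> cyl \<Omega> M0" "l \<in> {0..1}"
  shows "steepness \<kappa> Z (Y_curve \<kappa> s Z Y1 Y2 l)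
    = (1 - l) *\<^sub>R steepness \<kappa> Z Y1 + l *\<^sub>R steepness \<kappa> Z Y2"
proof -
  obtain t where "t > 0" "Y_curve \<kappa> s Z Y1 Y2 l = Z + t *\<^sub>R dir_curve \<kappa> Z Y1 Y2 l"
    using ray_meets_target[OF assms] by blast
  then show ?thesis using target_slope assms steepness_Lam[OF kappa]
    by (simp add: dir_curve_def)
qed

text \<open>Two points of the target with equal slopes lie on one ray from \<open>Z\<close>, which meets the target once.\<close>

lemma steepness_inj:
  assumes Y: "Y1 \<in> \<S>" "Y2 \<in> \<S>" and Z: "Z \<in> cyl \<Omega> M0"
    and eq: "steepness \<kappa> Z Y1 = steepness \<kappa> Z Y2"
  shows "Y1 = Y2"
proof -
  have Z0: "Z \<in> slab 0" using Z by (auto simp: cyl_def slab_def)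
  have "Y \<in> \<S> \<inter> {Z + t *\<^sub>R dir_curve \<kappa> Z Y1 Y2 0 | t. t > 0}"
    if "Y \<in> \<S>" "steepness \<kappa> Z Y = steepness \<kappa> Z Y1" for Y
  proof -
    have a: "axial \<kappa> Z Y > 0" using that target_subset by (intro axial_pos Z0) auto
    have "Y = Z + norm (Z - Y) *\<^sub>R dir_curve \<kappa> Z Y1 Y2 0"
      using Lam_steepness[OF kappa a] that target_slope[OF Y(1) Z] by (simp add: dir_curve_def)
    moreover have "norm (Z - Y) > 0" using a by (auto simp: axial_def)
    ultimately show ?thesis using that by blast
  qed
  from this[of Y1] this[of Y2] show ?thesis
    using ray_meets_target[OF Y Z, of 0] eq Y by auto
qed

text \<open>
  Choose \<open>w\<close> orthogonal to the difference \<open>b\<close> of the two slopes (this is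
  where the dimension must be at least two), so that all ellipsoids of the family agree to first
  order in the direction \<open>w\<close>. Bending the test line by a multiple of \<open>b\<close>
  makes the two extreme ellipsoids agree to second order as well. The minimum in the regularity
  condition is then equal to the affine interpolation, and the second order terms compare \<open>1 /
  axial\<close> at \<open>Y_Z(l)\<close> with the interpolated value.
\<close>

lemma regular_concave:
  assumes n: "2 \<le> CARD('n)" and Y: "Y1 \<in> \<S>" "Y2 \<in> \<S>" and Z: "Z \<in> cyl \<Omega> M0"
    and l: "l \<in> {0..1}" and c: "0 < c1" "0 < c2"
    and reg: "\<And>x. x \<in> \<Omega> \<Longrightarrow> norm (x - fst Z) \<le> c2 \<Longrightarrow>
       min (phi \<kappa> x Y1 Z) (phi \<kappa> x Y2 Z) + c1 * (norm (Y1 - Y2))\<^sup>2 * (norm (x - fst Z))\<^sup>2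
         \<le> phi \<kappa> x (Y_curve \<kappa> s Z Y1 Y2 l) Z"
  shows "(1 - l) * (1 / axial \<kappa> Z Y1) + l * (1 / axial \<kappa> Z Y2)
       + 2 * c1 / (1 + Vmax\<^sup>2) * (norm (Y1 - Y2))\<^sup>2
     \<le> 1 / axial \<kappa> Z (Y_curve \<kappa> s Z Y1 Y2 l)"
proof (cases "Y1 = Y2")
  case True
  then have "steepness \<kappa> Z (Y_curve \<kappa> s Z Y1 Y2 l) = steepness \<kappa> Z Y1"
    using steepness_Y_curve[OF Y Z l] by (simp flip: scaleR_add_left)
  then have "Y_curve \<kappa> s Z Y1 Y2 l = Y1"
    by (rule steepness_inj[OF Y_curve_target[OF Y Z l] Y(1) Z])
  then show ?thesis using True by (simp flip: add_divide_distrib)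
next
  case False
  define e where "e = M0 - snd Z"
  have Ze: "Z \<in> slab e" and e: "0 < e" using cyl_slab[OF Z] by (simp_all add: e_def)
  have Z0: "Z \<in> slab 0" using Ze slab_mono[of 0 e] e by auto
  have z: "fst Z \<in> \<Omega>" using Z by (auto simp: cyl_def)
  define Yl where "Yl = Y_curve \<kappa> s Z Y1 Y2 l"
  define v where "v Y = steepness \<kappa> Z Y" for Y
  define t where "t Y = 1 / axial \<kappa> Z Y" for Y
  define b where "b = v Y2 - v Y1"
  define d where "d = norm (Y1 - Y2)"
  have YT: "Y1 \<in> \<T>" "Y2 \<in> \<T>" "Yl \<in> \<T>"
    using Y Y_curve_target[OF Y Z l] target_subset by (auto simp: Yl_def)
  have vl: "v Yl = (1 - l) *\<^sub>R v Y1 + l *\<^sub>R v Y2"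
    using steepness_Y_curve[OF Y Z l] by (simp add: v_def Yl_def)
  have b0: "b \<noteq> 0" using False steepness_inj[OF Y Z] by (auto simp: b_def v_def)
  obtain w' :: "real^'n" where w': "w' \<noteq> 0" "orthogonal b w'"
    using orthogonal_to_vector_exists[of b] n by auto
  define w where "w = sgn w'"
  have w: "norm w = 1" "b \<bullet> w = 0" using w' by (auto simp: w_def norm_sgn orthogonal_def sgn_div_norm)
  define m where "m = v Y1 \<bullet> w"
  have m: "v Y1 \<bullet> w = m" "v Y2 \<bullet> w = m" using w(2) by (simp_all add: m_def b_def inner_diff_left)
  have ml: "v Yl \<bullet> w = m" unfolding vl by (simp add: inner_add_left m algebra_simps)
  define A where "A = quad \<kappa> (w, m)"
  have A: "0 < A" "A \<le> 1 + Vmax\<^sup>2"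
  proof -
    have "1 \<le> A" using quad_ge[of "(w, m)"] w by (simp add: A_def)
    then show "0 < A" by simp
    have "\<bar>m\<bar> \<le> norm (v Y1) * norm w" unfolding m_def by (rule Cauchy_Schwarz_ineq2)
    also have "\<dots> \<le> Vmax * norm w" using steepness_le[OF YT(1) Z0] w by (simp add: v_def)
    finally show "A \<le> 1 + Vmax\<^sup>2" using quad_le[of "(w, m)"] w by (simp add: A_def)
  qed
  \<comment> \<open>The length of \<open>a\<close> is the one for which \<open>L Y1 = L Y2\<close> below.\<close>
  define a where "a = ((t Y1 - t Y2) * A / 2 / (norm b)\<^sup>2) *\<^sub>R b"
  have ab: "a \<bullet> b = (t Y1 - t Y2) * A / 2" using b0 by (simp add: a_def power2_norm_eq_inner)
  define x where "x h = fst Z + h *\<^sub>R w + h\<^sup>2 *\<^sub>R a" for h :: real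
  define G where "G Y h = (phi \<kappa> (x h) Y Z - snd Z - h * m) / h\<^sup>2" for Y h
  define L where "L Y = v Y \<bullet> a + t Y * A / 2" for Y
  have lim: "(G Y \<longlongrightarrow> L Y) (at_right 0)" if "Y \<in> \<T>" "v Y \<bullet> w = m" for Y
    using phi_second_order[OF that(1) Ze e, of w a] that(2)
    by (simp add: G_def[abs_def] L_def x_def v_def t_def A_def)
  have px: "x h - fst Z = h *\<^sub>R (w + h *\<^sub>R a)" for h
    by (simp add: x_def algebra_simps power2_eq_square)
  have xlim: "(x \<longlongrightarrow> fst Z) (at_right 0)"
    unfolding x_def by (rule tendsto_eq_intros refl | simp)+
  have "\<forall>\<^sub>F h in at_right 0. x h \<in> \<Omega>" using topological_tendstoD[OF xlim open_Omega z] .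
  moreover have "\<forall>\<^sub>F h in at_right 0. x h \<in> ball (fst Z) c2"
    using topological_tendstoD[OF xlim, of "ball (fst Z) c2"] c by simp
  moreover have "\<forall>\<^sub>F h in at_right 0. 0 < (h::real)" by (simp add: eventually_at_right_less)
  ultimately have "\<forall>\<^sub>F h in at_right 0. min (G Y1 h) (G Y2 h) + c1 * d\<^sup>2 * (norm (w + h *\<^sub>R a))\<^sup>2 \<le> G Yl h"
  proof eventually_elim
    case (elim h)
    have "min (phi \<kappa> (x h) Y1 Z) (phi \<kappa> (x h) Y2 Z) + c1 * d\<^sup>2 * (norm (x h - fst Z))\<^sup>2
         \<le> phi \<kappa> (x h) Yl Z"
      unfolding Yl_def d_def using elim by (intro reg) (auto simp: dist_norm norm_minus_commute)
    moreover have "(norm (x h - fst Z))\<^sup>2 = h\<^sup>2 * (norm (w + h *\<^sub>R a))\<^sup>2"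
      using elim(3) by (simp add: px power_mult_distrib)
    moreover have "phi \<kappa> (x h) Y Z = snd Z + h * m + h\<^sup>2 * G Y h" for Y
      using elim(3) by (simp add: G_def)
    ultimately have "min (snd Z + h * m + h\<^sup>2 * G Y1 h) (snd Z + h * m + h\<^sup>2 * G Y2 h)
        + h\<^sup>2 * (c1 * d\<^sup>2 * (norm (w + h *\<^sub>R a))\<^sup>2) \<le> snd Z + h * m + h\<^sup>2 * G Yl h"
      by (simp add: mult_ac)
    then have "h\<^sup>2 * (min (G Y1 h) (G Y2 h) + c1 * d\<^sup>2 * (norm (w + h *\<^sub>R a))\<^sup>2) \<le> h\<^sup>2 * G Yl h"
      using elim(3) by (auto simp: min_def distrib_left split: if_splits)
    then show ?case using elim(3) by simp
  qed
  moreover have "((\<lambda>h. min (G Y1 h) (G Y2 h) + c1 * d\<^sup>2 * (norm (w + h *\<^sub>R a))\<^sup>2)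
      \<longlongrightarrow> min (L Y1) (L Y2) + c1 * d\<^sup>2) (at_right 0)"
    by (rule tendsto_eq_intros tendsto_min lim YT m refl | simp add: w)+
  ultimately have le: "min (L Y1) (L Y2) + c1 * d\<^sup>2 \<le> L Yl"
    by (intro tendsto_le[OF _ lim[OF YT(3) ml]]) auto
  have LL: "L Y1 = L Y2" using ab by (simp add: L_def b_def inner_diff_right inner_commute algebra_simps diff_divide_distrib)
  have "L Yl = (1 - l) * L Y1 + l * L Y2 + (t Yl - (1 - l) * t Y1 - l * t Y2) * A / 2"
    by (simp add: L_def vl inner_add_left algebra_simps diff_divide_distrib add_divide_distrib)
  also have "(1 - l) * L Y1 + l * L Y2 = min (L Y1) (L Y2)" using LL by (simp add: algebra_simps)
  finally have "c1 * d\<^sup>2 \<le> (t Yl - (1 - l) * t Y1 - l * t Y2) * A / 2" using le by simp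
  then have "2 * c1 * d\<^sup>2 / A \<le> t Yl - (1 - l) * t Y1 - l * t Y2" using A by (simp add: field_simps)
  moreover have "2 * c1 * d\<^sup>2 / (1 + Vmax\<^sup>2) \<le> 2 * c1 * d\<^sup>2 / A"
    using A c by (intro divide_left_mono) auto
  ultimately show ?thesis by (simp add: t_def d_def Yl_def)
qed

end

section \<open>Growth of the cost away from the contact point\<close>

context refraction_domain
begin

text \<open>
  Bounds the ratio of the second factor in \<open>cost_excess\<close> to the cost at
  \<open>Z\<close>, for points \<open>X\<close> at distance at most \<open>D\<close> from
  \<open>Z\<close>.
\<close>

definition spread :: "real \<Rightarrow> real \<Rightarrow> real" where
  "spread e D = 2 / (1 - \<kappa>) * (1 + 2 * D / ((1 - \<kappa>) * e))"

lemma spread_pos: "0 < e \<Longrightarrow> 0 \<le> D \<Longrightarrow> 0 < spread e D"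
  using kappa by (simp add: spread_def add_pos_nonneg)

lemma excess_nonneg:
  assumes Y: "Y \<in> \<T>" and Z: "Z \<in> slab 0" and X: "X \<in> slab 0"
    and c: "cost \<kappa> Z Y \<le> cost \<kappa> X Y"
  shows "0 \<le> excess \<kappa> Z Y (X - Z)"
proof -
  have "0 \<le> snd Y - snd X" using target_above[OF Y] X by (auto simp: slab_def)
  then have "0 \<le> (cost \<kappa> X Y - cost \<kappa> Z Y) * (2 * \<kappa> * (snd Y - snd X) + cost \<kappa> X Y + cost \<kappa> Z Y)"
    using c cost_pos[OF Y Z] cost_pos[OF Y X] kappa
    by (intro mult_nonneg_nonneg add_nonneg_nonneg) auto
  then show ?thesis
    using cost_excess[of \<kappa> Z Y X] axial_pos[OF Y Z] by (simp add: zero_le_mult_iff)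
qed

text \<open>
  In \<open>cost_excess\<close> both \<open>axial\<close> and the second factor are comparable to
  the cost at \<open>Z\<close>. That cost need not be bounded over the target, but it cancels.
\<close>

lemma cost_growth:
  assumes Y: "Y \<in> \<T>" and Z: "Z \<in> slab e" and e: "0 < e" and X: "X \<in> slab 0"
    and D: "norm (X - Z) \<le> D" and E: "0 \<le> E" "E \<le> excess \<kappa> Z Y (X - Z)"
  shows "2 * theta * E / spread e D \<le> cost \<kappa> X Y - cost \<kappa> Z Y"
proof -
  have Z0: "Z \<in> slab 0" using Z slab_mono[of 0 e] e by auto
  have D0: "0 \<le> D" using D norm_ge_zero order_trans by blast
  define c0 where "c0 = cost \<kappa> Z Y"
  define c1 where "c1 = cost \<kappa> X Y"
  define b where "b = snd Y - snd X"
  define S where "S = 2 * \<kappa> * b + c1 + c0"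
  have c0: "0 < c0" and c1: "0 < c1" using cost_pos Y Z0 X by (auto simp: c0_def c1_def)
  have b0: "0 \<le> b" using target_above[OF Y] X by (auto simp: slab_def b_def)
  have S0: "0 < S" using b0 c0 c1 kappa unfolding S_def
    by (intro add_nonneg_pos add_nonneg_nonneg) auto
  have "b \<le> norm (X - Y)" using snd_le_norm[of "X - Y"] by (simp add: b_def)
  also have "\<dots> \<le> c1 / (1 - \<kappa>)"
    using cost_ge[OF kappa(1), of X Y] kappa by (simp add: c1_def field_simps)
  finally have "2 * \<kappa> * b \<le> 2 * \<kappa> * (c1 / (1 - \<kappa>))" using kappa by (intro mult_left_mono) auto
  then have "S \<le> 2 * \<kappa> * (c1 / (1 - \<kappa>)) + c1 + c0" by (simp add: S_def)
  moreover have cc: "c1 \<le> c0 + 2 * D"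
    using cost_lipschitz[OF kappa, of X Y Z Y] D by (simp add: c0_def c1_def)
  have "2 * \<kappa> * (c1 / (1 - \<kappa>)) \<le> 2 * \<kappa> * ((c0 + 2 * D) / (1 - \<kappa>))"
    using cc kappa by (intro mult_left_mono divide_right_mono) auto
  ultimately have "S \<le> 2 * \<kappa> * ((c0 + 2 * D) / (1 - \<kappa>)) + (c0 + 2 * D) + (c0 + 2 * D)"
    using cc D0 by linarith
  also have "\<dots> = 2 / (1 - \<kappa>) * (c0 + 2 * D)" using kappa by (simp add: field_simps)
  also have "\<dots> \<le> 2 / (1 - \<kappa>) * (c0 + 2 * D / ((1 - \<kappa>) * e) * c0)"
  proof -
    have "2 * D / ((1 - \<kappa>) * e) * ((1 - \<kappa>) * e) \<le> 2 * D / ((1 - \<kappa>) * e) * c0"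
      using cost_lower[OF Y Z] kappa e D0 by (intro mult_left_mono) (auto simp: c0_def)
    then have "2 * D \<le> 2 * D / ((1 - \<kappa>) * e) * c0" using kappa e by simp
    then show ?thesis using kappa by (intro mult_left_mono) auto
  qed
  also have "\<dots> = spread e D * c0" using kappa by (simp add: spread_def algebra_simps)
  finally have S: "S \<le> spread e D * c0" .
  have ce: "(c1 - c0) * S = 2 * axial \<kappa> Z Y * excess \<kappa> Z Y (X - Z)"
    using cost_excess[of \<kappa> Z Y X] axial_pos[OF Y Z0] by (simp add: c0_def c1_def S_def b_def)
  have "0 \<le> (c1 - c0) * S" unfolding ce using E axial_pos[OF Y Z0] by simp
  then have c10: "0 \<le> c1 - c0" using S0 by (simp add: zero_le_mult_iff)
  have "(2 * theta * E) * c0 = 2 * (theta * c0) * E" by simp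
  also have "\<dots> \<le> 2 * axial \<kappa> Z Y * excess \<kappa> Z Y (X - Z)"
    using axial_ge[OF Y Z0] E axial_pos[OF Y Z0] theta_pos c0
    by (intro mult_mono) (auto simp: c0_def)
  also have "\<dots> = (c1 - c0) * S" using ce by simp
  also have "\<dots> \<le> (c1 - c0) * (spread e D * c0)" using S c10 by (rule mult_left_mono)
  finally have "(2 * theta * E) * c0 \<le> ((c1 - c0) * spread e D) * c0" by (simp add: mult_ac)
  then have "2 * theta * E \<le> (c1 - c0) * spread e D" using c0 by (rule mult_right_le_imp_le)
  then show ?thesis using spread_pos[OF e D0] by (simp add: c0_def c1_def pos_divide_le_eq)
qed

text \<open>
  Globalisation of the local regularity condition. At a point \<open>X\<close> outside the
  ellipsoids of \<open>Y1\<close> and \<open>Y2\<close> the excess of \<open>Yl\<close> is, by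
  affinity, at least \<open>g / 2\<close> times the quadratic form, wherever \<open>X\<close> lies.
  Replacing \<open>Yl\<close> by a point \<open>Y\<close> at distance at most \<open>\<rho>\<close>
  costs at most a term that is linear and one that is quadratic in the distance from
  \<open>Z\<close>; for distances at least \<open>\<eta>\<close> both are absorbed.
\<close>

lemma excess_tube:
  assumes T: "Y1 \<in> \<T>" "Y2 \<in> \<T>" "Yl \<in> \<T>" "Y \<in> \<T>"
    and Z: "Z \<in> slab e" and e: "0 < e" and X: "X \<in> slab 0"
    and l: "l \<in> {0..1}"
    and v: "steepness \<kappa> Z Yl = (1 - l) *\<^sub>R steepness \<kappa> Z Y1 + l *\<^sub>R steepness \<kappa> Z Y2"
    and t: "(1 - l) * (1 / axial \<kappa> Z Y1) + l * (1 / axial \<kappa> Z Y2) + g \<le> 1 / axial \<kappa> Z Yl"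
    and c: "cost \<kappa> Z Y1 \<le> cost \<kappa> X Y1" "cost \<kappa> Z Y2 \<le> cost \<kappa> X Y2"
    and r: "norm (Y - Yl) \<le> \<rho>" "Lip e * \<rho> \<le> g / 2" "Lip e * \<rho> \<le> g * \<eta> / 8"
    and g: "0 < g" and eta: "0 < \<eta>" "\<eta> \<le> norm (fst X - fst Z)"
  shows "g * \<eta>\<^sup>2 / 8 \<le> excess \<kappa> Z Y (X - Z)"
proof -
  have Z0: "Z \<in> slab 0" using Z slab_mono[of 0 e] e by auto
  define W where "W = X - Z"
  define q where "q = quad \<kappa> W"
  define n where "n = norm (fst W)"
  define a where "a = Lip e * \<rho>"
  have n: "\<eta> \<le> n" using eta by (simp add: n_def W_def)
  have q: "n\<^sup>2 \<le> q" using quad_ge[of W] by (simp add: n_def q_def)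
  then have q0: "0 \<le> q" using zero_le_power2 order_trans by blast
  have "0 \<le> (1 - l) * excess \<kappa> Z Y1 W + l * excess \<kappa> Z Y2 W"
    using l excess_nonneg[OF T(1) Z0 X c(1)] excess_nonneg[OF T(2) Z0 X c(2)]
    by (simp add: W_def)
  also have "\<dots> = excess \<kappa> Z Yl W
     - (1 / axial \<kappa> Z Yl - (1 - l) * (1 / axial \<kappa> Z Y1) - l * (1 / axial \<kappa> Z Y2)) * q / 2"
    by (simp add: excess_def v inner_add_left q_def[symmetric] algebra_simps
        add_divide_distrib diff_divide_distrib)
  also have "\<dots> \<le> excess \<kappa> Z Yl W - g * q / 2"
    using t q0 mult_right_mono[of g "1 / axial \<kappa> Z Yl - (1 - l) * (1 / axial \<kappa> Z Y1) - l * (1 / axial \<kappa> Z Y2)" q]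
    by simp
  finally have l1: "g * q / 2 \<le> excess \<kappa> Z Yl W" by simp
  have dv: "norm (steepness \<kappa> Z Y - steepness \<kappa> Z Yl) \<le> a"
  proof -
    have "norm (steepness \<kappa> Z Y - steepness \<kappa> Z Yl) \<le> Lip e * norm (Y - Yl)"
      using steepness_lipschitz[OF T(4,3) Z Z e] by simp
    also have "\<dots> \<le> a" using r Lip_pos[OF e] by (simp add: a_def)
    finally show ?thesis .
  qed
  have dt: "\<bar>1 / axial \<kappa> Z Y - 1 / axial \<kappa> Z Yl\<bar> \<le> a"
  proof -
    have "\<bar>1 / axial \<kappa> Z Y - 1 / axial \<kappa> Z Yl\<bar> \<le> Lip e * norm (Y - Yl)"
      using inv_axial_lipschitz[OF T(4,3) Z Z e] by simp
    also have "\<dots> \<le> a" using r Lip_pos[OF e] by (simp add: a_def)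
    finally show ?thesis .
  qed
  have e1: "\<bar>(steepness \<kappa> Z Y - steepness \<kappa> Z Yl) \<bullet> fst W\<bar> \<le> a * n"
  proof -
    have "\<bar>(steepness \<kappa> Z Y - steepness \<kappa> Z Yl) \<bullet> fst W\<bar>
        \<le> norm (steepness \<kappa> Z Y - steepness \<kappa> Z Yl) * n"
      unfolding n_def by (rule Cauchy_Schwarz_ineq2)
    also have "\<dots> \<le> a * n" using dv by (intro mult_right_mono) (auto simp: n_def)
    finally show ?thesis .
  qed
  have e2: "\<bar>(1 / axial \<kappa> Z Y - 1 / axial \<kappa> Z Yl) * q / 2\<bar> \<le> a * q / 2"
    using dt q0 by (simp add: abs_mult mult_right_mono)
  have "excess \<kappa> Z Y W = excess \<kappa> Z Yl W + (steepness \<kappa> Z Y - steepness \<kappa> Z Yl) \<bullet> fst W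
     + (1 / axial \<kappa> Z Y - 1 / axial \<kappa> Z Yl) * q / 2"
    by (simp add: excess_def q_def inner_diff_left algebra_simps diff_divide_distrib)
  then have "g * q / 2 - a * n - a * q / 2 \<le> excess \<kappa> Z Y W" using l1 e1 e2 by linarith
  moreover have "a * q \<le> g / 2 * q" using r q0 by (intro mult_right_mono) (auto simp: a_def)
  moreover have "a * n \<le> g * \<eta> / 8 * n" using r by (intro mult_right_mono) (auto simp: a_def n_def)
  moreover have "g * \<eta> / 8 * n \<le> g * n / 8 * n"
    using n g eta by (intro mult_right_mono) auto
  moreover have "g * n / 8 * n = g * n\<^sup>2 / 8" by (simp add: power2_eq_square)
  moreover have "g * n\<^sup>2 \<le> g * q" using q g by simp
  moreover have "g * \<eta>\<^sup>2 \<le> g * n\<^sup>2" using n g eta by (simp add: power_mono)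
  ultimately have "g * \<eta>\<^sup>2 / 8 \<le> excess \<kappa> Z Y W" by linarith
  then show ?thesis by (simp add: W_def)
qed

end

section \<open>Parallel refractors\<close>

locale refractor = refraction_target \<kappa> M0 \<delta>0 \<Omega> \<S> s
  for \<kappa> M0 \<delta>0 :: real and \<Omega> :: "(real^'n::finite) set" and \<S> :: "'n point set"
    and s :: "'n point \<Rightarrow> 'n point \<Rightarrow> real" +
  fixes u :: "real^'n \<Rightarrow> real"
  assumes refractor: "parallel_refractor \<kappa> M0 \<Omega> \<S> u" and bounded_Omega: "bounded \<Omega>"
begin

abbreviation gph where "gph x \<equiv> (x, u x)"
abbreviation F where "F \<equiv> refr_map \<kappa> \<Omega> \<S> u"

lemma gph_slab: "x \<in> \<Omega> \<Longrightarrow> gph x \<in> slab 0"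
  using refractor by (auto simp: parallel_refractor_def slab_def)

lemma F_nonempty: "x \<in> \<Omega> \<Longrightarrow> \<exists>Y. Y \<in> F x"
  using refractor by (auto simp: parallel_refractor_def)

lemma F_target: "Y \<in> F x \<Longrightarrow> Y \<in> \<S>" "Y \<in> F x \<Longrightarrow> Y \<in> \<T>"
  using target_subset by (auto simp: refr_map_def)

text \<open>The supporting condition as a minimisation, which is how all elements of \<open>F x\<close> are found.\<close>

lemma F_iff:
  assumes "x \<in> \<Omega>"
  shows "Y \<in> F x \<longleftrightarrow> Y \<in> \<S> \<and> (\<forall>x'\<in>\<Omega>. cost \<kappa> (gph x) Y \<le> cost \<kappa> (gph x') Y)"
proof -
  have "u x' \<le> phi \<kappa> x' Y (gph x) \<longleftrightarrow> cost \<kappa> (gph x) Y \<le> cost \<kappa> (gph x') Y"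
    if "Y \<in> \<S>" "x' \<in> \<Omega>" for x'
    using le_phi_iff[of Y "gph x" "gph x'"] gph_slab assms that target_subset by auto
  then show ?thesis by (auto simp: refr_map_def)
qed

lemma F_le: "Y \<in> F x \<Longrightarrow> x' \<in> \<Omega> \<Longrightarrow> u x' \<le> phi \<kappa> x' Y (gph x)"
  by (simp add: refr_map_def)

lemma u_lipschitz:
  assumes "x \<in> \<Omega>" "x' \<in> \<Omega>"
  shows "\<bar>u x - u x'\<bar> \<le> Vmax * norm (x - x')"
proof -
  have *: "u x' \<le> u x + Vmax * norm (x - x')" if x: "x \<in> \<Omega>" "x' \<in> \<Omega>" for x x'
  proof -
    obtain Y where Y: "Y \<in> F x" using F_nonempty x by blast
    have "u x' \<le> phi \<kappa> x' Y (gph x)" using F_le[OF Y x(2)] .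
    then show ?thesis
      using phi_lipschitz[OF F_target(2)[OF Y] gph_slab[OF x(1)] x] phi_base[OF F_target(2)[OF Y] gph_slab[OF x(1)]]
      by simp
  qed
  show ?thesis using *[OF assms] *[OF assms(2,1)] by (simp add: abs_le_iff norm_minus_commute)
qed

lemma gph_lipschitz:
  assumes "x \<in> \<Omega>" "x' \<in> \<Omega>"
  shows "norm (gph x - gph x') \<le> (1 + Vmax) * norm (x - x')"
proof -
  have "norm (gph x - gph x') \<le> norm (x - x') + norm (u x - u x')"
    using norm_Pair_le[of "x - x'" "u x - u x'"] by simp
  then show ?thesis using u_lipschitz[OF assms] by (simp add: algebra_simps)
qed

lemma continuous_gph: "continuous_on \<Omega> gph"
proof (rule continuous_on_Pair[OF continuous_on_id])
  have "lipschitz_on Vmax \<Omega> u"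
    using u_lipschitz Vmax_pos by (intro lipschitz_onI) (auto simp: dist_norm)
  then show "continuous_on \<Omega> u" by (rule lipschitz_on_continuous_on)
qed

lemma u_expansion:
  assumes Y: "Y \<in> F x" and x: "x \<in> \<Omega>" "gph x \<in> slab e" "0 < e" and x': "x' \<in> \<Omega>"
  shows "u x' \<le> u x + steepness \<kappa> (gph x) Y \<bullet> (x' - x) + Cq e * (norm (x' - x))\<^sup>2"
  using F_le[OF Y x'] phi_expansion[OF F_target(2)[OF Y] x(2,3) x'] by (simp add: abs_le_iff)

text \<open>
  Without this the upper bound on the measure of the image of a ball could not be used, as
  \<open>emeasure\<close> vanishes on sets that are not measurable. The image of a compact set is
  closed in the target, by \<open>F_iff\<close> and projection along the compact factor, and a ball
  is a countable union of compact sets.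
\<close>

lemma F_ball_measurable:
  assumes "ball z \<eta> \<subseteq> \<Omega>"
  shows "(\<Union>x\<in>ball z \<eta>. F x) \<in> sets (restrict_space borel \<S>)"
proof -
  have clo: "(\<Union>x\<in>K. F x) \<in> sets (restrict_space borel \<S>)" if K: "compact K" "K \<subseteq> \<Omega>" for K
  proof -
    define U where "U = (\<Inter>x'\<in>\<Omega>. {p \<in> K \<times> \<S>. cost \<kappa> (gph (fst p)) (snd p) - cost \<kappa> (gph x') (snd p) \<le> 0})"
    have cont: "continuous_on (K \<times> \<S>) (\<lambda>p. gph (fst p))"
      by (rule continuous_on_compose2[OF continuous_on_subset[OF continuous_gph K(2)] continuous_on_fst])
        (auto intro: continuous_intros)
    have ne: "\<Omega> \<noteq> {}" by (rule Omega_nonempty)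
    have "closedin (top_of_set (K \<times> \<S>)) U" unfolding U_def
    proof (rule closedin_INT[OF ne])
      fix x' assume "x' \<in> \<Omega>"
      have "continuous_on (K \<times> \<S>) (\<lambda>p. cost \<kappa> (gph (fst p)) (snd p) - cost \<kappa> (gph x') (snd p))"
        unfolding cost_def by (intro continuous_intros cont)
      from continuous_closedin_preimage[OF this, of "{..0}"]
      show "closedin (top_of_set (K \<times> \<S>)) {p \<in> K \<times> \<S>. cost \<kappa> (gph (fst p)) (snd p) - cost \<kappa> (gph x') (snd p) \<le> 0}"
        by (simp add: vimage_def Int_def)
    qed
    from closedin_compact_projection[OF K(1) this]
    have "closedin (top_of_set \<S>) {Y. \<exists>x. x \<in> K \<and> (x, Y) \<in> U}" .
    moreover have "{Y. \<exists>x. x \<in> K \<and> (x, Y) \<in> U} = (\<Union>x\<in>K. F x)"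
      using F_iff K(2) ne by (auto simp: U_def) blast+
    ultimately obtain C where C: "closed C" "(\<Union>x\<in>K. F x) = \<S> \<inter> C"
      unfolding closedin_closed by auto
    then show ?thesis unfolding sets_restrict_space by auto
  qed
  have "ball z \<eta> = (\<Union>n. cball z (\<eta> - 1 / real (Suc n)))"
  proof (intro set_eqI iffI)
    fix x assume "x \<in> ball z \<eta>"
    then have "0 < \<eta> - dist z x" by simp
    then obtain n where "inverse (real (Suc n)) < \<eta> - dist z x" using reals_Archimedean by blast
    then show "x \<in> (\<Union>n. cball z (\<eta> - 1 / real (Suc n)))"
      by (auto simp: inverse_eq_divide intro!: exI[of _ n])
  next
    fix x assume "x \<in> (\<Union>n. cball z (\<eta> - 1 / real (Suc n)))"
    then obtain n where "dist z x \<le> \<eta> - 1 / real (Suc n)" by auto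
    moreover have "0 < 1 / real (Suc n)" by simp
    ultimately have "dist z x < \<eta>" by linarith
    then show "x \<in> ball z \<eta>" by simp
  qed
  then have "(\<Union>x\<in>ball z \<eta>. F x) = (\<Union>n. \<Union>x\<in>cball z (\<eta> - 1 / real (Suc n)). F x)" by auto
  also have "\<dots> \<in> sets (restrict_space borel \<S>)"
  proof (rule sets.countable_nat_UN, rule image_subsetI)
    fix n
    have "\<eta> - 1 / real (Suc n) < \<eta>" by simp
    then have "cball z (\<eta> - 1 / real (Suc n)) \<subseteq> ball z \<eta>"
      unfolding subset_iff mem_cball mem_ball by (meson le_less_trans)
    then show "(\<Union>x\<in>cball z (\<eta> - 1 / real (Suc n)). F x) \<in> sets (restrict_space borel \<S>)"
      using assms by (intro clo) auto
  qed
  finally show ?thesis .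
qed

lemma gph_dist:
  assumes "x \<in> \<Omega>" "Z \<in> slab 0"
  shows "norm (gph x - Z) \<le> diameter \<Omega> + M0"
proof -
  have "norm (gph x - Z) \<le> norm (x - fst Z) + \<bar>u x - snd Z\<bar>"
    using norm_Pair_le[of "fst (gph x - Z)" "snd (gph x - Z)"] unfolding prod.collapse by simp
  moreover have "norm (x - fst Z) \<le> diameter \<Omega>"
    using diameter_bounded_bound[OF bounded_Omega assms(1), of "fst Z"] assms(2)
    by (auto simp: slab_def dist_norm)
  moreover have "\<bar>u x - snd Z\<bar> \<le> M0" using gph_slab[OF assms(1)] assms(2) by (auto simp: slab_def)
  ultimately show ?thesis by linarith
qed

definition spreadu where "spreadu e = spread e (diameter \<Omega> + M0)"

lemma spreadu_pos: "0 < e \<Longrightarrow> 0 < spreadu e"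
  unfolding spreadu_def using diameter_ge_0[OF bounded_Omega] M0_pos by (intro spread_pos) auto

text \<open>
  The cost of the graph with respect to \<open>Y\<close> attains a minimum on the closed ball. At
  the centre the cost exceeds \<open>c(Z, Y)\<close> at most by twice the height of \<open>Z\<close>
  over the graph, whereas on the rest of \<open>\<Omega>\<close> it exceeds \<open>c(Z, Y)\<close>
  by more. The minimum is thus attained inside the ball, and it is a minimum over all of
  \<open>\<Omega>\<close>.
\<close>

lemma tube_subset:
  assumes T: "Y1 \<in> \<S>" "Y2 \<in> \<S>" "Yl \<in> \<S>" "Y \<in> \<S>"
    and Z: "Z \<in> slab e" and e: "0 < e"
    and l: "l \<in> {0..1}"
    and v: "steepness \<kappa> Z Yl = (1 - l) *\<^sub>R steepness \<kappa> Z Y1 + l *\<^sub>R steepness \<kappa> Z Y2"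
    and t: "(1 - l) * (1 / axial \<kappa> Z Y1) + l * (1 / axial \<kappa> Z Y2) + g \<le> 1 / axial \<kappa> Z Yl"
    and c: "\<And>x. x \<in> \<Omega> \<Longrightarrow> cost \<kappa> Z Y1 \<le> cost \<kappa> (gph x) Y1"
      "\<And>x. x \<in> \<Omega> \<Longrightarrow> cost \<kappa> Z Y2 \<le> cost \<kappa> (gph x) Y2"
    and r: "norm (Y - Yl) \<le> \<rho>" "Lip e * \<rho> \<le> g / 2" "Lip e * \<rho> \<le> g * \<eta> / 8"
    and g: "0 < g" and eta: "0 < \<eta>" "cball (fst Z) \<eta> \<subseteq> \<Omega>"
    and tau: "8 * spreadu e * \<bar>snd Z - u (fst Z)\<bar> < theta * g * \<eta>\<^sup>2"
  shows "Y \<in> (\<Union>x\<in>ball (fst Z) \<eta>. F x)"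
proof -
  have T': "Y1 \<in> \<T>" "Y2 \<in> \<T>" "Yl \<in> \<T>" "Y \<in> \<T>" using T target_subset by auto
  have Z0: "Z \<in> slab 0" using Z slab_mono[of 0 e] e by auto
  have z: "fst Z \<in> \<Omega>" using Z by (auto simp: slab_def)
  define f where "f x = cost \<kappa> (gph x) Y" for x
  have "continuous_on (cball (fst Z) \<eta>) f" unfolding f_def cost_def
    by (intro continuous_intros continuous_on_subset[OF continuous_gph eta(2)]
        continuous_on_compose2[OF continuous_on_snd[OF continuous_on_id] continuous_on_subset[OF continuous_gph eta(2)]]) auto
  then obtain x0 where x0: "x0 \<in> cball (fst Z) \<eta>" "\<And>x. x \<in> cball (fst Z) \<eta> \<Longrightarrow> f x0 \<le> f x"
    using continuous_attains_inf[of "cball (fst Z) \<eta>" f] eta(1) by auto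
  \<comment> \<open>This is where the choice of \<open>\<eta>\<close> against the height of \<open>Z\<close> over the graph is used.\<close>
  have far: "f (fst Z) < f x" if x: "x \<in> \<Omega>" "\<eta> \<le> norm (x - fst Z)" for x
  proof -
    have "g * \<eta>\<^sup>2 / 8 \<le> excess \<kappa> Z Y (gph x - Z)"
      using excess_tube[OF T' Z e gph_slab[OF x(1)] l v t c(1)[OF x(1)] c(2)[OF x(1)] r g eta(1)] x(2)
      by simp
    from cost_growth[OF T'(4) Z e gph_slab[OF x(1)] gph_dist[OF x(1) Z0] _ this]
    have "2 * theta * (g * \<eta>\<^sup>2 / 8) / spreadu e \<le> f x - cost \<kappa> Z Y"
      using g by (simp add: spreadu_def f_def)
    moreover have "2 * \<bar>snd Z - u (fst Z)\<bar> < 2 * theta * (g * \<eta>\<^sup>2 / 8) / spreadu e"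
      using tau spreadu_pos[OF e] by (simp add: field_simps)
    moreover have "f (fst Z) - cost \<kappa> Z Y \<le> 2 * \<bar>snd Z - u (fst Z)\<bar>"
    proof -
      have "gph (fst Z) - Z = (0, u (fst Z) - snd Z)" by (simp add: prod_eq_iff)
      then have "norm (gph (fst Z) - Z) = \<bar>snd Z - u (fst Z)\<bar>" by simp
      then show ?thesis using cost_lipschitz[OF kappa, of "gph (fst Z)" Y Z Y] by (simp add: f_def)
    qed
    ultimately show ?thesis by linarith
  qed
  have fz: "f x0 \<le> f (fst Z)" using x0(2)[of "fst Z"] eta by simp
  have x0O: "x0 \<in> \<Omega>" using x0(1) eta by auto
  have "x0 \<in> ball (fst Z) \<eta>"
  proof (rule ccontr)
    assume "x0 \<notin> ball (fst Z) \<eta>"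
    then show False using far[OF x0O] fz by (simp add: dist_norm norm_minus_commute)
  qed
  moreover have "f x0 \<le> f x" if "x \<in> \<Omega>" for x
  proof (cases "x \<in> cball (fst Z) \<eta>")
    case True then show ?thesis by (rule x0(2))
  next
    case False
    then show ?thesis using far[OF that] fz by (simp add: dist_norm norm_minus_commute)
  qed
  then have "Y \<in> F x0" using F_iff[OF x0O] T(4) by (simp add: f_def)
  ultimately show ?thesis by blast
qed

text \<open>
  The contact point comes from the intermediate value theorem. Its height over the graph is
  estimated by comparing with the chord from \<open>(x1, u x1)\<close> to \<open>(x2, u x2)\<close>:
  the supporting ellipsoid at \<open>z\<close> keeps the chord at most a quadratic term above the
  graph, and the ellipsoids of \<open>Y1\<close> and \<open>Y2\<close> put \<open>Z\<close> above
  the chord at most by the difference of their slopes times \<open>norm (x1 - x2)\<close> plus a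
  quadratic term.
\<close>

lemma contact_point:
  assumes x: "x1 \<in> \<Omega>" "x2 \<in> \<Omega>" and seg: "closed_segment x1 x2 \<subseteq> \<Omega>"
    and sl: "\<And>x. x \<in> closed_segment x1 x2 \<Longrightarrow> gph x \<in> slab e" and e: "0 < e"
    and Y: "Y1 \<in> F x1" "Y2 \<in> F x2"
  obtains Z where "fst Z \<in> closed_segment x1 x2" "u (fst Z) \<le> snd Z"
    "cost \<kappa> Z Y1 = cost \<kappa> (gph x1) Y1" "cost \<kappa> Z Y2 = cost \<kappa> (gph x2) Y2"
    "snd Z \<le> u x1 + Vmax * norm (fst Z - x1)"
    "snd Z - u (fst Z) \<le> norm (steepness \<kappa> (gph x1) Y1 - steepness \<kappa> (gph x2) Y2) * norm (x1 - x2)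
       + 2 * Cq e * (norm (x1 - x2))\<^sup>2"
proof -
  have T: "Y1 \<in> \<T>" "Y2 \<in> \<T>" using Y F_target by auto
  define p where "p l = (1 - l) *\<^sub>R x1 + l *\<^sub>R x2" for l :: real
  have p: "p l \<in> closed_segment x1 x2" if "l \<in> {0..1}" for l
    using that by (auto simp: p_def closed_segment_def)
  define h where "h l = phi \<kappa> (p l) Y1 (gph x1) - phi \<kappa> (p l) Y2 (gph x2)" for l
  have cp: "continuous_on \<Omega> (\<lambda>x. phi \<kappa> x Y' (gph x'))" if "Y' \<in> \<T>" "x' \<in> \<Omega>" for Y' x'
  proof -
    have "lipschitz_on Vmax \<Omega> (\<lambda>x. phi \<kappa> x Y' (gph x'))"
      using phi_lipschitz[OF that(1) gph_slab[OF that(2)]] Vmax_pos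
      by (intro lipschitz_onI) (auto simp: dist_norm)
    then show ?thesis by (rule lipschitz_on_continuous_on)
  qed
  have "continuous_on {0..1} p" unfolding p_def by (intro continuous_intros)
  then have ch: "continuous_on {0..1} h" unfolding h_def
    using p seg by (intro continuous_on_diff continuous_on_compose2[OF cp[OF T(1) x(1)]]
      continuous_on_compose2[OF cp[OF T(2) x(2)]]) auto
  have "h 0 \<le> 0"
    using F_le[OF Y(2) x(1)] phi_base[OF T(1) gph_slab[OF x(1)]] by (simp add: h_def p_def)
  moreover have "0 \<le> h 1"
    using F_le[OF Y(1) x(2)] phi_base[OF T(2) gph_slab[OF x(2)]] by (simp add: h_def p_def)
  ultimately obtain l where l: "0 \<le> l" "l \<le> 1" "h l = 0"
    using IVT'[of h 0 0 1] ch by auto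
  define z where "z = p l"
  define d where "d = norm (x1 - x2)"
  have zs: "z \<in> closed_segment x1 x2" using p l by (simp add: z_def)
  then have z: "z \<in> \<Omega>" using seg by blast
  define z3 where "z3 = phi \<kappa> z Y1 (gph x1)"
  have z3': "z3 = phi \<kappa> z Y2 (gph x2)" using l(3) by (simp add: z3_def h_def z_def)
  have s1: "gph x1 \<in> slab e" and s2: "gph x2 \<in> slab e" and s3: "gph z \<in> slab e"
    using sl zs by auto
  define v1 where "v1 = steepness \<kappa> (gph x1) Y1"
  define v2 where "v2 = steepness \<kappa> (gph x2) Y2"
  have zx: "z - x1 = l *\<^sub>R (x2 - x1)" "z - x2 = - ((1 - l) *\<^sub>R (x2 - x1))"
    by (simp_all add: z_def p_def algebra_simps)
  have C: "0 \<le> Cq e" using axial_min_pos[OF e] by (simp add: Cq_def)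
  have n1: "norm (z - x1) \<le> d" "norm (z - x2) \<le> d"
    using l by (auto simp: zx d_def norm_minus_commute intro: mult_left_le_one_le)
  then have n: "Cq e * (norm (z - x1))\<^sup>2 \<le> Cq e * d\<^sup>2" "Cq e * (norm (z - x2))\<^sup>2 \<le> Cq e * d\<^sup>2"
    using C by (auto intro!: mult_left_mono power_mono)
  have "z3 \<le> u x1 + v1 \<bullet> (z - x1) + Cq e * d\<^sup>2"
    using phi_expansion[OF T(1) s1 e z] n by (simp add: z3_def v1_def abs_le_iff)
  then have a1: "z3 \<le> u x1 + l * (v1 \<bullet> (x2 - x1)) + Cq e * d\<^sup>2" by (simp add: zx)
  have "z3 \<le> u x2 + v2 \<bullet> (z - x2) + Cq e * d\<^sup>2"
    using phi_expansion[OF T(2) s2 e z] n by (simp add: z3' v2_def abs_le_iff)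
  then have a2: "z3 \<le> u x2 - (1 - l) * (v2 \<bullet> (x2 - x1)) + Cq e * d\<^sup>2" by (simp add: zx)
  obtain Y where Yz: "Y \<in> F z" using F_nonempty z by blast
  define v where "v = steepness \<kappa> (gph z) Y"
  have "u x1 \<le> u z + v \<bullet> (x1 - z) + Cq e * d\<^sup>2"
    using u_expansion[OF Yz z s3 e x(1)] n by (simp add: v_def norm_minus_commute)
  moreover have "x1 - z = - (l *\<^sub>R (x2 - x1))" using zx(1) by (metis minus_diff_eq)
  ultimately have b1: "u x1 \<le> u z - l * (v \<bullet> (x2 - x1)) + Cq e * d\<^sup>2" by simp
  have "u x2 \<le> u z + v \<bullet> (x2 - z) + Cq e * d\<^sup>2"
    using u_expansion[OF Yz z s3 e x(2)] n by (simp add: v_def norm_minus_commute)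
  moreover have "x2 - z = (1 - l) *\<^sub>R (x2 - x1)" using zx(2) by (metis minus_diff_eq minus_minus)
  ultimately have b2: "u x2 \<le> u z + (1 - l) * (v \<bullet> (x2 - x1)) + Cq e * d\<^sup>2" by simp
  have cs: "\<bar>(v1 - v2) \<bullet> (x2 - x1)\<bar> \<le> norm (v1 - v2) * d"
    unfolding d_def using Cauchy_Schwarz_ineq2[of "v1 - v2" "x2 - x1"] by (simp add: norm_minus_commute)
  \<comment> \<open>In the average with weights \<open>1 - l\<close> and \<open>l\<close> the terms with the slope \<open>v\<close> at \<open>z\<close> cancel.\<close>
  have up: "z3 - u z \<le> norm (v1 - v2) * d + 2 * Cq e * d\<^sup>2"
  proof -
    have "(1 - l) * z3 + l * z3
       \<le> (1 - l) * (u z - l * (v \<bullet> (x2 - x1)) + Cq e * d\<^sup>2 + l * (v1 \<bullet> (x2 - x1)) + Cq e * d\<^sup>2)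
         + l * (u z + (1 - l) * (v \<bullet> (x2 - x1)) + Cq e * d\<^sup>2 - (1 - l) * (v2 \<bullet> (x2 - x1)) + Cq e * d\<^sup>2)"
      using l a1 a2 b1 b2 by (intro add_mono mult_left_mono) linarith+
    also have "\<dots> = u z + (l * (1 - l)) * ((v1 - v2) \<bullet> (x2 - x1)) + 2 * Cq e * d\<^sup>2"
      by (simp add: algebra_simps inner_diff_left)
    also have "(l * (1 - l)) * ((v1 - v2) \<bullet> (x2 - x1)) \<le> 1 * \<bar>(v1 - v2) \<bullet> (x2 - x1)\<bar>"
    proof -
      have "(l * (1 - l)) * ((v1 - v2) \<bullet> (x2 - x1)) \<le> (l * (1 - l)) * \<bar>(v1 - v2) \<bullet> (x2 - x1)\<bar>"
        using l by (intro mult_left_mono) auto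
      also have "\<dots> \<le> 1 * \<bar>(v1 - v2) \<bullet> (x2 - x1)\<bar>"
        using l by (intro mult_right_mono mult_le_one) auto
      finally show ?thesis .
    qed
    finally show ?thesis using cs by (simp add: algebra_simps)
  qed
  show ?thesis
  proof (rule that[of "(z, z3)"])
    show "u (fst (z, z3)) \<le> snd (z, z3)" using F_le[OF Y(1) z] by (simp add: z3_def)
    show "cost \<kappa> (z, z3) Y1 = cost \<kappa> (gph x1) Y1"
      using cost_phi_target[OF T(1) gph_slab[OF x(1)] z] by (simp add: z3_def)
    show "cost \<kappa> (z, z3) Y2 = cost \<kappa> (gph x2) Y2"
      using cost_phi_target[OF T(2) gph_slab[OF x(2)] z] by (simp add: z3')
    show "snd (z, z3) \<le> u x1 + Vmax * norm (fst (z, z3) - x1)"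
      using phi_lipschitz[OF T(1) gph_slab[OF x(1)] z x(1)] phi_base[OF T(1) gph_slab[OF x(1)]]
      by (simp add: z3_def)
  qed (use zs up in \<open>simp_all add: v1_def v2_def d_def\<close>)
qed

end

section \<open>Holder dependence of the focus\<close>

text \<open>
  With \<open>\<eta>\<close> of order \<open>(\<Delta> / d) powr (1 / 2)\<close> the hypothesis
  reads \<open>d powr (2 * n - 1) \<le> const * (\<Delta> / d) powr p\<close>; collecting the powers
  of \<open>d\<close> gives \<open>\<alpha> = p / (2 * n - 1 + p)\<close>. The condition on
  \<open>q\<close> says that \<open>p\<close> is positive.
\<close>

lemma balance_exponents:
  fixes d \<Delta> :: real
  assumes n: "2 \<le> (n::nat)" and q: "1 \<le> q" "q < real n / (real n - 1)"
    and al: "\<alpha> = (real n / (2 * q) - (real n - 1) / 2) / (1 + 3 / 2 * (real n - 1) + real n / (2 * q))"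
    and pos: "0 < d" "0 < \<Delta>" "0 < A" "0 < B" "0 < c" "0 < C"
    and eta: "\<eta> = sqrt (B * \<Delta> / d)"
    and le: "c * (A * d\<^sup>2 * \<eta>) ^ (n - 1) * d \<le> C * \<eta> powr (real n / q)"
  defines "p \<equiv> (real n / q - (real n - 1)) / 2"
  shows "d \<le> (C / (c * A ^ (n - 1)) * B powr p) powr (1 / (2 * real n - 1 + p)) * \<Delta> powr \<alpha>"
proof -
  have n1: "1 < real n" using n by simp
  have p: "0 < p" using q n1 by (simp add: p_def field_simps)
  define r where "r = 2 * real n - 1 + p"
  have r: "0 < r" using n1 p by (simp add: r_def)
  have e0: "0 < \<eta>" using pos by (simp add: eta)
  define K where "K = C / (c * A ^ (n - 1))"
  have K: "0 < K" using pos by (simp add: K_def)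
  have m: "real (n - 1) = real n - 1" using n by (simp add: of_nat_diff)
  have "(A * d\<^sup>2 * \<eta>) ^ (n - 1) = A ^ (n - 1) * d powr (2 * (real n - 1)) * \<eta> powr (real n - 1)"
    using pos e0 m by (simp add: power_mult_distrib powr_realpow[symmetric] powr_powr
        flip: powr_numeral)
  then have "c * A ^ (n - 1) * (d powr (2 * (real n - 1)) * d powr 1 * \<eta> powr (real n - 1))
      \<le> C * \<eta> powr (real n / q)" using le pos by (simp add: mult_ac)
  then have bound: "d powr (2 * (real n - 1)) * d powr 1 * \<eta> powr (real n - 1) \<le> K * \<eta> powr (real n / q)"
    using pos by (simp add: K_def field_simps)
  have pd: "d powr (2 * (real n - 1)) * d powr 1 = d powr (2 * real n - 1)"
    by (simp only: powr_add[symmetric]) (simp add: algebra_simps)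
  have pe: "\<eta> powr (real n / q) = \<eta> powr (2 * p) * \<eta> powr (real n - 1)"
  proof -
    have "2 * p + (real n - 1) = real n / q" unfolding p_def by argo
    then show ?thesis by (simp only: powr_add[symmetric])
  qed
  have "d powr (2 * real n - 1) * \<eta> powr (real n - 1) \<le> (K * \<eta> powr (2 * p)) * \<eta> powr (real n - 1)"
    using bound unfolding pd pe by (simp only: mult.assoc)
  then have "d powr (2 * real n - 1) \<le> K * \<eta> powr (2 * p)" using e0 by simp
  also have "\<eta> powr (2 * p) = (B * \<Delta> / d) powr p"
    using pos by (simp add: eta powr_half_sqrt[symmetric] powr_powr)
  also have "\<dots> = B powr p * \<Delta> powr p / d powr p"
    using pos by (simp add: powr_mult powr_divide)
  finally have "d powr (2 * real n - 1) * d powr p \<le> K * B powr p * \<Delta> powr p"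
    using pos by (simp add: field_simps)
  then have "d powr r \<le> K * B powr p * \<Delta> powr p" by (simp add: r_def powr_add)
  then have "(d powr r) powr (1 / r) \<le> (K * B powr p * \<Delta> powr p) powr (1 / r)"
    using r by (intro powr_mono2) auto
  also have "(d powr r) powr (1 / r) = d" using r pos by (simp add: powr_powr)
  also have "(K * B powr p * \<Delta> powr p) powr (1 / r) = (K * B powr p) powr (1 / r) * \<Delta> powr (p / r)"
    using K pos by (simp add: powr_mult powr_powr)
  also have "p / r = \<alpha>"
    unfolding al p_def r_def by (simp add: field_simps)
  finally show ?thesis by (simp add: K_def r_def)
qed

lemma exponent_bounds:
  assumes n: "2 \<le> (n::nat)" and q: "1 \<le> q" "q < real n / (real n - 1)"
    and al: "\<alpha> = (real n / (2 * q) - (real n - 1) / 2) / (1 + 3 / 2 * (real n - 1) + real n / (2 * q))"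
  shows "0 < \<alpha>" "\<alpha> \<le> 1"
proof -
  have n1: "1 < real n" using n by simp
  have num: "0 < real n / (2 * q) - (real n - 1) / 2" using q n1 by (simp add: field_simps)
  have den: "0 < 1 + 3 / 2 * (real n - 1) + real n / (2 * q)"
    using n1 q by (intro add_pos_pos) auto
  show "0 < \<alpha>" unfolding al using num den by (rule divide_pos_pos)
  have "real n / (2 * q) - (real n - 1) / 2 \<le> 1 + 3 / 2 * (real n - 1) + real n / (2 * q)"
    using n1 by argo
  then show "\<alpha> \<le> 1" unfolding al using den by simp
qed

context refractor
begin

text \<open>
  The constants below are fixed by three requirements: all points under consideration stay in the
  neighbourhoods in which regularity and the tube condition hold; \<open>B\<close> makes the growth
  at distance \<open>\<eta>\<close> exceed the height \<open>K3 * d * \<Delta>\<close> of the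
  contact point; \<open>a\<close> makes the tube of radius \<open>\<rho> = a * g * \<eta>\<close>
  thin enough for \<open>tube_subset\<close> and for the tube condition. The last requirement would
  fail for distant \<open>Y1\<close> and \<open>Y2\<close> if \<open>g = c3 * d\<^sup>2\<close>
  could be large. Yet regularity itself bounds it: \<open>g\<close> is at most the value of \<open>1
  / axial\<close> at a point of the target, which is at most \<open>1 / m\<close>. The estimate is
  trivial for \<open>d \<le> \<Delta>\<close>, and also if \<open>\<eta>\<close> is not small,
  because then \<open>d\<close> is at most a multiple of \<open>\<Delta>\<close>.
\<close>

lemma target_distance_estimate:
  fixes \<sigma> :: "'n point measure"
  assumes n: "2 \<le> CARD('n)"
    and sets: "sets \<sigma> = sets (restrict_space borel \<S>)"
    and xs: "(xs, u xs) \<in> cyl \<Omega> M0"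
    and reg: "regular_from \<kappa> M0 \<Omega> \<S> s (xs, u xs)"
    and C0: "0 < C0" and q: "1 \<le> q" "q < real CARD('n) / (real CARD('n) - 1)"
    and growth: "\<And>a \<eta>. \<eta> > 0 \<Longrightarrow> ball a \<eta> \<subseteq> \<Omega> \<Longrightarrow>
           emeasure \<sigma> (\<Union>x\<in>ball a \<eta>. F x) \<le> ennreal (C0 * \<eta> powr (real CARD('n) / q))"
    and tube: "tube_condition \<kappa> M0 \<Omega> \<S> s \<sigma> (xs, u xs)"
    and al: "\<alpha> = (real CARD('n) / (2 * q) - (real CARD('n) - 1) / 2)
             / (1 + 3 / 2 * (real CARD('n) - 1) + real CARD('n) / (2 * q))"
  obtains \<delta> e K where "0 < \<delta>" "\<delta> \<le> 1 / 2" "0 < e" "0 < K" "ball xs \<delta> \<subseteq> \<Omega>"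
    "\<And>x. x \<in> ball xs \<delta> \<Longrightarrow> gph x \<in> slab e"
    "\<And>x1 x2 Y1 Y2. x1 \<in> ball xs \<delta> \<Longrightarrow> x2 \<in> ball xs \<delta> \<Longrightarrow> x1 \<noteq> x2 \<Longrightarrow> Y1 \<in> F x1 \<Longrightarrow> Y2 \<in> F x2
       \<Longrightarrow> norm (Y1 - Y2) \<le> K * norm (x1 - x2) powr \<alpha>"
proof -
  have alb: "0 < \<alpha>" "\<alpha> \<le> 1" using exponent_bounds[OF n q al] by auto
  have xsO: "xs \<in> \<Omega>" and uxs: "u xs < M0" using xs by (auto simp: cyl_def)
  obtain U1 c1 c2 where U1: "open U1" "gph xs \<in> U1" "U1 \<subseteq> cyl \<Omega> M0" and c12: "0 < c1" "0 < c2"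
    and reg': "\<forall>Y1\<in>\<S>. \<forall>Y2\<in>\<S>. \<forall>Z\<in>U1. \<forall>l\<in>{1/4..3/4}. \<forall>x\<in>\<Omega>. norm (x - fst Z) \<le> c2 \<longrightarrow>
       phi \<kappa> x (Y_curve \<kappa> s Z Y1 Y2 l) Z
         \<ge> min (phi \<kappa> x Y1 Z) (phi \<kappa> x Y2 Z) + c1 * (norm (Y1 - Y2))\<^sup>2 * (norm (x - fst Z))\<^sup>2"
    using reg unfolding regular_from_def by (elim exE conjE) (rule that)
  note reg1 = reg'[rule_format]
  obtain U2 Cc \<rho>0 where U2: "open U2" "gph xs \<in> U2" and Cc: "0 < Cc" and \<rho>0: "0 < \<rho>0"
    and tube': "\<forall>Y1\<in>\<S>. \<forall>Y2\<in>\<S>. \<forall>Z\<in>U2. \<forall>\<rho>\<in>{0<..<\<rho>0}.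
       emeasure \<sigma> (nbhd \<rho> (Y_curve \<kappa> s Z Y1 Y2 ` {1/4..3/4}) \<inter> \<S>)
         \<ge> ennreal (Cc * \<rho> ^ (CARD('n) - 1) * norm (Y1 - Y2))"
    using tube unfolding tube_condition_def by (elim exE conjE) (rule that)
  note tube1 = tube'[rule_format]
  define e where "e = (M0 - u xs) / 2"
  have e: "0 < e" using uxs by (simp add: e_def)
  define W where "W = U1 \<inter> U2 \<inter> {Z. snd Z < M0 - e}"
  have "open {Z :: 'n point. snd Z < M0 - e}" by (intro open_Collect_less continuous_intros)
  then have "open W" using U1 U2 by (auto simp: W_def)
  moreover have "gph xs \<in> W" using U1 U2 uxs by (simp add: W_def e_def field_simps)
  ultimately obtain r0 where r0: "0 < r0" "ball (gph xs) r0 \<subseteq> W" using open_contains_ball by blast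
  obtain \<eta>1 where \<eta>1: "0 < \<eta>1" "ball xs \<eta>1 \<subseteq> \<Omega>" using open_Omega xsO open_contains_ball by blast
  define \<eta>0 where "\<eta>0 = \<eta>1 / 2"
  have \<eta>0: "0 < \<eta>0" using \<eta>1 by (simp add: \<eta>0_def)
  define \<delta> where "\<delta> = min \<eta>0 (min (1/2) (r0 / (1 + 3 * Vmax)))"
  have \<delta>: "0 < \<delta>" "\<delta> \<le> \<eta>0" "\<delta> \<le> 1/2" "(1 + 3 * Vmax) * \<delta> \<le> r0"
  proof -
    show "0 < \<delta>" using \<eta>0 r0 Vmax_pos by (simp add: \<delta>_def)
    show "\<delta> \<le> \<eta>0" "\<delta> \<le> 1/2" unfolding \<delta>_def by linarith+
    have "\<delta> \<le> r0 / (1 + 3 * Vmax)" by (simp add: \<delta>_def)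
    then show "(1 + 3 * Vmax) * \<delta> \<le> r0" using Vmax_pos by (simp add: field_simps)
  qed
  have B\<Omega>: "ball xs \<delta> \<subseteq> \<Omega>" using \<delta> \<eta>1 \<eta>0 by (auto simp: \<eta>0_def)
  have near: "Z \<in> W" if "norm (fst Z - xs) < \<delta>" "\<bar>snd Z - u xs\<bar> \<le> 3 * Vmax * \<delta>" for Z
  proof -
    have "norm (Z - gph xs) \<le> norm (fst Z - xs) + \<bar>snd Z - u xs\<bar>"
      using norm_Pair_le[of "fst (Z - gph xs)" "snd (Z - gph xs)"] unfolding prod.collapse by simp
    also have "\<dots> < r0" using that \<delta>(4) by (simp add: algebra_simps)
    finally show ?thesis using r0(2) by (auto simp: dist_norm norm_minus_commute)
  qed
  have Wslab: "Z \<in> cyl \<Omega> M0" "Z \<in> slab e" if "Z \<in> W" for Z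
  proof -
    show "Z \<in> cyl \<Omega> M0" using that U1(3) by (auto simp: W_def)
    then show "Z \<in> slab e" using that by (auto simp: W_def cyl_def slab_def)
  qed
  have dx: "\<bar>u x - u xs\<bar> \<le> Vmax * \<delta>" "norm (x - xs) < \<delta>" if "x \<in> ball xs \<delta>" for x
  proof -
    show 1: "norm (x - xs) < \<delta>" using that by (simp add: dist_norm norm_minus_commute)
    have "\<bar>u x - u xs\<bar> \<le> Vmax * norm (x - xs)" using u_lipschitz that B\<Omega> xsO by blast
    also have "\<dots> \<le> Vmax * \<delta>" using 1 Vmax_pos by simp
    finally show "\<bar>u x - u xs\<bar> \<le> Vmax * \<delta>" .
  qed
  have gslab: "gph x \<in> slab e" if "x \<in> ball xs \<delta>" for x
  proof (rule Wslab(2)[OF near])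
    show "norm (fst (gph x) - xs) < \<delta>" using dx(2)[OF that] by simp
    have "Vmax * \<delta> \<le> 3 * Vmax * \<delta>" using Vmax_pos \<delta> by simp
    then show "\<bar>snd (gph x) - u xs\<bar> \<le> 3 * Vmax * \<delta>" using dx(1)[OF that] by simp
  qed
  define c3 where "c3 = 2 * c1 / (1 + Vmax\<^sup>2)"
  have c3: "0 < c3" using c12 by (simp add: c3_def add_pos_nonneg)
  define L where "L = Lip e"
  have L: "0 < L" using Lip_pos[OF e] by (simp add: L_def)
  define m where "m = axial_min e"
  have m: "0 < m" using axial_min_pos[OF e] by (simp add: m_def)
  have Cq0: "0 \<le> Cq e" using axial_min_pos[OF e] by (simp add: Cq_def)
  define K2 where "K2 = spreadu e"
  have K2: "0 < K2" using spreadu_pos[OF e] by (simp add: K2_def)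
  define K3 where "K3 = L * (2 + Vmax) + 2 * Cq e"
  have K3: "0 < K3" using L Vmax_pos Cq0 by (simp add: K3_def add_pos_nonneg)
  \<comment> \<open>Any factor above \<open>8\<close> in place of \<open>16\<close> gives the strict inequality required by \<open>tube_subset\<close>.\<close>
  define B where "B = 16 * K2 * K3 / (theta * c3)"
  have B: "0 < B" using K2 K3 theta_pos c3 by (simp add: B_def)
  define a where "a = min (1 / (8 * L)) (min (1 / (2 * L * \<eta>0)) (\<rho>0 * m / \<eta>0))"
  have a0: "0 < a" using L \<eta>0 \<rho>0 m by (simp add: a_def)
  have "a \<le> 1 / (8 * L)" "a \<le> 1 / (2 * L * \<eta>0)" "a \<le> \<rho>0 * m / \<eta>0" by (auto simp: a_def)
  then have a: "L * a \<le> 1 / 8" "L * a * \<eta>0 \<le> 1 / 2" "a * \<eta>0 \<le> \<rho>0 * m"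
    using L \<eta>0 by (auto simp: field_simps)
  define A where "A = a * c3"
  have A: "0 < A" using a0 c3 by (simp add: A_def)
  define p where "p = (real CARD('n) / q - (real CARD('n) - 1)) / 2"
  define K4 where "K4 = (C0 / (Cc * A ^ (CARD('n) - 1)) * B powr p) powr (1 / (2 * real CARD('n) - 1 + p))"
  have K4: "0 \<le> K4" by (simp add: K4_def)
  define K where "K = 1 + B / \<eta>0\<^sup>2 + K4"
  have K: "0 < K" using B \<eta>0 K4 by (simp add: K_def add_pos_nonneg)
  have main: "norm (Y1 - Y2) \<le> K * norm (x1 - x2) powr \<alpha>"
    if x: "x1 \<in> ball xs \<delta>" "x2 \<in> ball xs \<delta>" "x1 \<noteq> x2" and Y: "Y1 \<in> F x1" "Y2 \<in> F x2"
    for x1 x2 Y1 Y2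
  proof -
    define d where "d = norm (Y1 - Y2)"
    define \<Delta> where "\<Delta> = norm (x1 - x2)"
    have \<Delta>0: "0 < \<Delta>" using x by (simp add: \<Delta>_def)
    have "\<Delta> \<le> norm (x1 - xs) + norm (x2 - xs)"
      using norm_triangle_ineq4[of "x1 - xs" "x2 - xs"] by (simp add: \<Delta>_def)
    then have \<Delta>1: "\<Delta> \<le> 1" using dx(2)[OF x(1)] dx(2)[OF x(2)] \<delta>(3) by linarith
    have \<Delta>\<alpha>: "\<Delta> \<le> \<Delta> powr \<alpha>" using powr_mono'[of \<alpha> 1 \<Delta>] alb \<Delta>0 \<Delta>1 by simp
    have \<Delta>p: "0 \<le> \<Delta> powr \<alpha>" by simp
    have xO: "x1 \<in> \<Omega>" "x2 \<in> \<Omega>" using x B\<Omega> by auto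
    have YS: "Y1 \<in> \<S>" "Y2 \<in> \<S>" using Y F_target by auto
    have Kle: "K' * \<Delta> powr \<alpha> \<le> K * \<Delta> powr \<alpha>" if "K' \<le> K" for K'
      using that \<Delta>p by (rule mult_right_mono)
    show ?thesis
    proof (cases "d \<le> \<Delta>")
      case True
      then have "d \<le> 1 * \<Delta> powr \<alpha>" using \<Delta>\<alpha> by simp
      also have "\<dots> \<le> K * \<Delta> powr \<alpha>" using B \<eta>0 K4 by (intro Kle) (simp add: K_def)
      finally show ?thesis by (simp add: d_def \<Delta>_def)
    next
      case False
      then have d0: "0 < d" and \<Delta>d: "\<Delta> < d" using \<Delta>0 by auto
      define \<eta> where "\<eta> = sqrt (B * \<Delta> / d)"
      have \<eta>: "0 < \<eta>" using B \<Delta>0 d0 by (simp add: \<eta>_def)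
      have \<eta>2: "\<eta>\<^sup>2 = B * \<Delta> / d" using B \<Delta>0 d0 by (simp add: \<eta>_def)
      show ?thesis
      proof (cases "\<eta>0 \<le> \<eta>")
        case True
        then have "\<eta>0\<^sup>2 \<le> B * \<Delta> / d" using \<eta>0 \<eta>2 by (metis power_mono less_imp_le)
        then have "d \<le> B / \<eta>0\<^sup>2 * \<Delta>" using d0 \<eta>0 by (simp add: field_simps)
        also have "\<dots> \<le> B / \<eta>0\<^sup>2 * \<Delta> powr \<alpha>" using B \<Delta>\<alpha> by (intro mult_left_mono) auto
        also have "\<dots> \<le> K * \<Delta> powr \<alpha>" using K4 by (intro Kle) (simp add: K_def)
        finally show ?thesis by (simp add: d_def \<Delta>_def)
      next
        case False
        then have \<eta>\<eta>0: "\<eta> < \<eta>0" by simp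
        have seg: "closed_segment x1 x2 \<subseteq> ball xs \<delta>"
          using x convex_ball by (simp add: closed_segment_subset)
        obtain Z where Zs: "fst Z \<in> closed_segment x1 x2" and uZ: "u (fst Z) \<le> snd Z"
          and cZ: "cost \<kappa> Z Y1 = cost \<kappa> (gph x1) Y1" "cost \<kappa> Z Y2 = cost \<kappa> (gph x2) Y2"
          and Z3: "snd Z \<le> u x1 + Vmax * norm (fst Z - x1)"
          and \<tau>: "snd Z - u (fst Z)
             \<le> norm (steepness \<kappa> (gph x1) Y1 - steepness \<kappa> (gph x2) Y2) * norm (x1 - x2)
                + 2 * Cq e * (norm (x1 - x2))\<^sup>2"
        proof (rule contact_point[OF xO _ _ e Y])
          show "closed_segment x1 x2 \<subseteq> \<Omega>" using seg B\<Omega> by blast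
          show "gph x \<in> slab e" if "x \<in> closed_segment x1 x2" for x using gslab seg that by blast
        qed
        have zB: "fst Z \<in> ball xs \<delta>" using Zs seg by blast
        have ZW: "Z \<in> W"
        proof (rule near)
          show "norm (fst Z - xs) < \<delta>" using dx(2)[OF zB] .
          have "norm (fst Z - x1) \<le> norm (fst Z - xs) + norm (x1 - xs)"
            using norm_triangle_ineq4[of "fst Z - xs" "x1 - xs"] by simp
          then have "norm (fst Z - x1) \<le> 2 * \<delta>" using dx(2)[OF zB] dx(2)[OF x(1)] by simp
          then have "Vmax * norm (fst Z - x1) \<le> Vmax * (2 * \<delta>)" using Vmax_pos by simp
          moreover have "Vmax * \<delta> \<ge> 0" using Vmax_pos \<delta> by simp
          ultimately show "\<bar>snd Z - u xs\<bar> \<le> 3 * Vmax * \<delta>"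
            using Z3 uZ dx(1)[OF x(1)] dx(1)[OF zB] by (simp add: abs_le_iff)
        qed
        note ZC = Wslab(1)[OF ZW] and Ze = Wslab(2)[OF ZW]
        have ZU: "Z \<in> U1" "Z \<in> U2" using ZW by (auto simp: W_def)
        define g where "g = c3 * d\<^sup>2"
        have g: "0 < g" using c3 d0 by (simp add: g_def)
        have conc: "(1 - l) * (1 / axial \<kappa> Z Y1) + l * (1 / axial \<kappa> Z Y2) + g
            \<le> 1 / axial \<kappa> Z (Y_curve \<kappa> s Z Y1 Y2 l)" if "l \<in> {1/4..3/4}" for l
        proof -
          have "l \<in> {0..1}" using that by auto
          from regular_concave[OF n YS ZC this c12 reg1[OF YS ZU(1) that]]
          show ?thesis by (simp add: g_def c3_def d_def)
        qed
        have gm: "g \<le> 1 / m"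
        proof -
          have Z0: "Z \<in> slab 0" using Ze slab_mono[of 0 e] e by auto
          have "0 < axial \<kappa> Z Y1" "0 < axial \<kappa> Z Y2"
            by (rule axial_pos[OF F_target(2)[OF Y(1)] Z0], rule axial_pos[OF F_target(2)[OF Y(2)] Z0])
          then have "0 \<le> (1 - 1/2) * (1 / axial \<kappa> Z Y1) + 1/2 * (1 / axial \<kappa> Z Y2)" by simp
          then have "g \<le> 1 / axial \<kappa> Z (Y_curve \<kappa> s Z Y1 Y2 (1/2))" using conc[of "1/2"] by simp
          also have "\<dots> \<le> 1 / m" unfolding m_def
            using Y_curve_target[OF YS ZC, of "1/2"] target_subset by (intro inv_axial_le[OF _ Ze e]) auto
          finally show ?thesis .
        qed
        define \<rho> where "\<rho> = a * g * \<eta>"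
        have \<rho>: "0 < \<rho>" using a0 g \<eta> by (simp add: \<rho>_def)
        have "\<rho> < a * (1 / m) * \<eta>0"
        proof -
          have "\<rho> < a * g * \<eta>0" using a0 g \<eta>\<eta>0 by (simp add: \<rho>_def)
          also have "\<dots> \<le> a * (1 / m) * \<eta>0" using a0 gm \<eta>0 by (intro mult_right_mono mult_left_mono) auto
          finally show ?thesis .
        qed
        also have "\<dots> \<le> \<rho>0" using a(3) m by (simp add: field_simps)
        finally have \<rho>1: "\<rho> \<in> {0<..<\<rho>0}" using \<rho> by simp
        have L1: "Lip e * \<rho> \<le> g / 2"
        proof -
          have "Lip e * \<rho> = L * a * \<eta> * g" by (simp add: \<rho>_def L_def)
          also have "\<dots> \<le> L * a * \<eta>0 * g" using L a0 \<eta>\<eta>0 g by (intro mult_right_mono mult_left_mono) auto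
          also have "\<dots> \<le> 1 / 2 * g" using a(2) g by (intro mult_right_mono) auto
          finally show ?thesis by simp
        qed
        have L2: "Lip e * \<rho> \<le> g * \<eta> / 8"
        proof -
          have "Lip e * \<rho> = L * a * (g * \<eta>)" by (simp add: \<rho>_def L_def)
          also have "\<dots> \<le> 1 / 8 * (g * \<eta>)" using a(1) g \<eta> by (intro mult_right_mono) auto
          finally show ?thesis by simp
        qed
        have "snd Z - u (fst Z) \<le> K3 * (\<Delta> * d)"
        proof -
          have "norm (steepness \<kappa> (gph x1) Y1 - steepness \<kappa> (gph x2) Y2)
              \<le> L * (norm (gph x1 - gph x2) + d)"
            unfolding L_def d_def using F_target(2) Y gslab x e by (intro steepness_lipschitz) auto
          also have "\<dots> \<le> L * ((1 + Vmax) * \<Delta> + d)"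
            using gph_lipschitz[OF xO] L by (simp add: \<Delta>_def)
          also have "\<dots> \<le> L * ((1 + Vmax) * d + d)"
            using \<Delta>d L Vmax_pos by simp
          finally have "norm (steepness \<kappa> (gph x1) Y1 - steepness \<kappa> (gph x2) Y2) * \<Delta>
              \<le> L * ((1 + Vmax) * d + d) * \<Delta>" using \<Delta>0 by simp
          moreover have "Cq e * \<Delta>\<^sup>2 \<le> Cq e * (\<Delta> * d)"
            using Cq0 \<Delta>d \<Delta>0 by (intro mult_left_mono) (auto simp: power2_eq_square)
          moreover have "L * ((1 + Vmax) * d + d) * \<Delta> + 2 * (Cq e * (\<Delta> * d)) = K3 * (\<Delta> * d)"
            by (simp add: K3_def algebra_simps)
          ultimately show ?thesis using \<tau> by (simp add: \<Delta>_def)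
        qed
        then have "8 * K2 * \<bar>snd Z - u (fst Z)\<bar> \<le> 8 * K2 * (K3 * (\<Delta> * d))"
          using uZ K2 by simp
        also have "\<dots> < 16 * K2 * K3 * (\<Delta> * d)" using K2 K3 \<Delta>0 d0 by simp
        also have "\<dots> = theta * g * \<eta>\<^sup>2"
        proof -
          have "theta * c3 * B = 16 * K2 * K3" using theta_pos c3 by (simp add: B_def)
          moreover have "theta * g * \<eta>\<^sup>2 = (theta * c3 * B) * (\<Delta> * d)"
            unfolding g_def \<eta>2 using d0 by (simp add: power2_eq_square)
          ultimately show ?thesis by simp
        qed
        finally have tau: "8 * spreadu e * \<bar>snd Z - u (fst Z)\<bar> < theta * g * \<eta>\<^sup>2" by (simp add: K2_def)
        have cb: "cball (fst Z) \<eta> \<subseteq> \<Omega>"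
        proof
          fix x assume "x \<in> cball (fst Z) \<eta>"
          then have "dist xs x < \<eta>1"
            using dist_triangle[of xs x "fst Z"] zB \<eta>\<eta>0 \<delta>(2) by (simp add: \<eta>0_def)
          then show "x \<in> \<Omega>" using \<eta>1 by auto
        qed
        have "nbhd \<rho> (Y_curve \<kappa> s Z Y1 Y2 ` {1/4..3/4}) \<inter> \<S> \<subseteq> (\<Union>x\<in>ball (fst Z) \<eta>. F x)"
        proof
          fix Y' assume "Y' \<in> nbhd \<rho> (Y_curve \<kappa> s Z Y1 Y2 ` {1/4..3/4}) \<inter> \<S>"
          then obtain l where l: "l \<in> {1/4..3/4}" and Y': "Y' \<in> \<S>" "dist (Y_curve \<kappa> s Z Y1 Y2 l) Y' < \<rho>"
            by (auto simp: nbhd_def)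
          have l1: "l \<in> {0..1}" using l by auto
          show "Y' \<in> (\<Union>x\<in>ball (fst Z) \<eta>. F x)"
          proof (rule tube_subset[OF YS Y_curve_target[OF YS ZC l1] Y'(1) Ze e l1
                steepness_Y_curve[OF YS ZC l1] conc[OF l] _ _ _ L1 L2 g \<eta> cb tau])
            show "cost \<kappa> Z Y1 \<le> cost \<kappa> (gph x) Y1" "cost \<kappa> Z Y2 \<le> cost \<kappa> (gph x) Y2" if "x \<in> \<Omega>" for x
              using cZ F_iff[OF xO(1), of Y1] F_iff[OF xO(2), of Y2] Y that by auto
            show "norm (Y' - Y_curve \<kappa> s Z Y1 Y2 l) \<le> \<rho>"
              using Y'(2) by (simp add: dist_norm norm_minus_commute)
          qed
        qed
        moreover have bO: "ball (fst Z) \<eta> \<subseteq> \<Omega>" using cb ball_subset_cball by blast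
        moreover have "(\<Union>x\<in>ball (fst Z) \<eta>. F x) \<in> sets \<sigma>"
          using F_ball_measurable[OF bO] sets by simp
        ultimately have "emeasure \<sigma> (nbhd \<rho> (Y_curve \<kappa> s Z Y1 Y2 ` {1/4..3/4}) \<inter> \<S>)
            \<le> emeasure \<sigma> (\<Union>x\<in>ball (fst Z) \<eta>. F x)" by (intro emeasure_mono)
        also have "\<dots> \<le> ennreal (C0 * \<eta> powr (real CARD('n) / q))" by (rule growth[OF \<eta> bO])
        finally have "ennreal (Cc * \<rho> ^ (CARD('n) - 1) * d) \<le> ennreal (C0 * \<eta> powr (real CARD('n) / q))"
          using tube1[OF YS ZU(2) \<rho>1] unfolding d_def by (rule order_trans[rotated])
        then have "Cc * \<rho> ^ (CARD('n) - 1) * d \<le> C0 * \<eta> powr (real CARD('n) / q)"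
          using C0 by (subst (asm) ennreal_le_iff) auto
        then have "Cc * (A * d\<^sup>2 * \<eta>) ^ (CARD('n) - 1) * d \<le> C0 * \<eta> powr (real CARD('n) / q)"
          by (simp add: \<rho>_def g_def A_def mult.assoc)
        from balance_exponents[OF n q al d0 \<Delta>0 A B Cc C0 \<eta>_def this]
        have "d \<le> K4 * \<Delta> powr \<alpha>" by (simp add: K4_def p_def)
        also have "\<dots> \<le> K * \<Delta> powr \<alpha>" using B \<eta>0 by (intro Kle) (simp add: K_def)
        finally show ?thesis by (simp add: d_def \<Delta>_def)
      qed
    qed
  qed
  show thesis by (rule that[OF \<delta>(1,3) e K B\<Omega> gslab main])
qed

text \<open>
  A supporting ellipsoid at \<open>x\<close> bounds \<open>u\<close> from above up to second order;
  one at \<open>x'\<close> bounds it from below at \<open>x'\<close>, with the slope at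
  \<open>x'\<close> in place of the slope at \<open>x\<close>. The two slopes are Holder close, so
  \<open>u\<close> is differentiable at \<open>x\<close> and its gradient is the slope of any
  supporting ellipsoid there.
\<close>

lemma C1_Holder:
  assumes alb: "0 < \<alpha>" "\<alpha> \<le> 1" and \<delta>: "0 < \<delta>" "\<delta> \<le> 1 / 2" and e: "0 < e" and K: "0 < K"
    and B\<Omega>: "ball xs \<delta> \<subseteq> \<Omega>"
    and sl: "\<And>x. x \<in> ball xs \<delta> \<Longrightarrow> gph x \<in> slab e"
    and dist: "\<And>x1 x2 Y1 Y2. x1 \<in> ball xs \<delta> \<Longrightarrow> x2 \<in> ball xs \<delta> \<Longrightarrow> x1 \<noteq> x2 \<Longrightarrow> Y1 \<in> F x1 \<Longrightarrow> Y2 \<in> F x2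
       \<Longrightarrow> norm (Y1 - Y2) \<le> K * norm (x1 - x2) powr \<alpha>"
  shows "\<exists>C>0. C1_Holder_on \<alpha> (ball xs \<delta>) u
           \<and> (\<forall>x1\<in>ball xs \<delta>. \<forall>x2\<in>ball xs \<delta>.
                norm (gradient u x1 - gradient u x2) \<le> C * norm (x1 - x2) powr \<alpha>)"
proof -
  let ?B = "ball xs \<delta>"
  obtain Y where Y: "\<And>x. x \<in> \<Omega> \<Longrightarrow> Y x \<in> F x" using F_nonempty by metis
  define v where "v x = steepness \<kappa> (gph x) (Y x)" for x
  have Cq0: "0 \<le> Cq e" using axial_min_pos[OF e] by (simp add: Cq_def)
  define C where "C = Lip e * (1 + Vmax + K)"
  have C: "0 < C" using Lip_pos[OF e] Vmax_pos K by (simp add: C_def)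
  have small: "norm (x - x') \<le> 1" if "x \<in> ?B" "x' \<in> ?B" for x x'
    using norm_triangle_ineq4[of "x - xs" "x' - xs"] that \<delta> by (simp add: dist_norm norm_minus_commute)
  have le_powr: "t \<le> t powr \<alpha>" if "0 \<le> t" "t \<le> 1" for t :: real
    using powr_mono'[of \<alpha> 1 t] alb that by (cases "t = 0") auto
  have vH: "norm (v x - v x') \<le> C * norm (x - x') powr \<alpha>" if x: "x \<in> ?B" "x' \<in> ?B" for x x'
  proof (cases "x = x'")
    case False
    have xO: "x \<in> \<Omega>" "x' \<in> \<Omega>" using x B\<Omega> by auto
    have "norm (v x - v x') \<le> Lip e * (norm (gph x - gph x') + norm (Y x - Y x'))"
      unfolding v_def
      by (rule steepness_lipschitz[OF F_target(2)[OF Y[OF xO(1)]] F_target(2)[OF Y[OF xO(2)]]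
            sl[OF x(1)] sl[OF x(2)] e])
    also have "\<dots> \<le> Lip e * ((1 + Vmax) * norm (x - x') powr \<alpha> + K * norm (x - x') powr \<alpha>)"
    proof (intro mult_left_mono add_mono)
      have "norm (gph x - gph x') \<le> (1 + Vmax) * norm (x - x')" by (rule gph_lipschitz[OF xO])
      also have "\<dots> \<le> (1 + Vmax) * norm (x - x') powr \<alpha>"
        using le_powr[of "norm (x - x')"] small[OF x] Vmax_pos by (intro mult_left_mono) auto
      finally show "norm (gph x - gph x') \<le> (1 + Vmax) * norm (x - x') powr \<alpha>" .
      show "norm (Y x - Y x') \<le> K * norm (x - x') powr \<alpha>"
        using dist[OF x False Y[OF xO(1)] Y[OF xO(2)]] .
    qed (use Lip_pos[OF e] in auto)
    also have "\<dots> = C * norm (x - x') powr \<alpha>" by (simp add: C_def algebra_simps)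
    finally show ?thesis .
  qed simp
  have GD: "GDERIV u x :> v x" if x: "x \<in> ?B" for x
  proof (rule GDERIV_of_powr_bound[OF open_ball x alb(1), of "Cq e + C"])
    show "0 \<le> Cq e + C" using Cq0 C by simp
    fix x' assume x': "x' \<in> ?B"
    have xO: "x \<in> \<Omega>" "x' \<in> \<Omega>" using x x' B\<Omega> by auto
    define t where "t = norm (x' - x)"
    have t: "0 \<le> t" "t \<le> 1" using small[OF x' x] by (auto simp: t_def)
    have 1: "u x' \<le> u x + v x \<bullet> (x' - x) + Cq e * t\<^sup>2"
      using u_expansion[OF Y[OF xO(1)] xO(1) sl[OF x] e xO(2)] by (simp add: v_def t_def)
    have 2: "u x \<le> u x' + v x' \<bullet> (x - x') + Cq e * t\<^sup>2"
      using u_expansion[OF Y[OF xO(2)] xO(2) sl[OF x'] e xO(1)] by (simp add: v_def t_def norm_minus_commute)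
    have "\<bar>(v x' - v x) \<bullet> (x' - x)\<bar> \<le> norm (v x' - v x) * t"
      unfolding t_def by (rule Cauchy_Schwarz_ineq2)
    also have "\<dots> \<le> C * t powr \<alpha> * t" using vH[OF x' x] t by (intro mult_right_mono) (auto simp: t_def)
    finally have 3: "\<bar>(v x' - v x) \<bullet> (x' - x)\<bar> \<le> C * t powr \<alpha> * t" .
    have "v x' \<bullet> (x - x') = - (v x \<bullet> (x' - x)) - (v x' - v x) \<bullet> (x' - x)"
      by (simp add: inner_diff_left inner_diff_right)
    with 1 2 3 have "\<bar>u x' - u x - v x \<bullet> (x' - x)\<bar> \<le> Cq e * t\<^sup>2 + C * t powr \<alpha> * t"
      using C t Cq0 unfolding abs_le_iff by (smt (verit) mult_nonneg_nonneg powr_ge_zero)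
    also have "\<dots> \<le> Cq e * (t powr \<alpha> * t) + C * t powr \<alpha> * t"
      using le_powr[OF t] t Cq0 by (intro add_right_mono mult_left_mono) (auto simp: power2_eq_square mult_right_mono)
    also have "\<dots> = (Cq e + C) * t powr (1 + \<alpha>)"
      using t by (cases "t = 0") (auto simp: powr_add algebra_simps)
    finally show "\<bar>u x' - u x - v x \<bullet> (x' - x)\<bar> \<le> (Cq e + C) * norm (x' - x) powr (1 + \<alpha>)"
      by (simp add: t_def)
  qed
  have grad: "gradient u x = v x" if "x \<in> ?B" for x by (rule gradient_eqI[OF GD[OF that]])
  have H: "\<forall>x1\<in>?B. \<forall>x2\<in>?B. norm (gradient u x1 - gradient u x2) \<le> C * norm (x1 - x2) powr \<alpha>"
    using vH grad by simp
  have "continuous_on ?B (gradient u)" unfolding continuous_on_def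
  proof
    fix x assume x: "x \<in> ?B"
    have "((\<lambda>y. norm (y - x)) \<longlongrightarrow> norm (x - x)) (at x within ?B)" by (intro tendsto_intros)
    then have "((\<lambda>y. norm (y - x) powr \<alpha>) \<longlongrightarrow> 0) (at x within ?B)"
      using tendsto_powr'[of "\<lambda>y. norm (y - x)" 0 "at x within ?B" "\<lambda>_. \<alpha>" \<alpha>] alb by auto
    from tendsto_mult_left[OF this, of C]
    have "((\<lambda>y. C * norm (y - x) powr \<alpha>) \<longlongrightarrow> 0) (at x within ?B)" by simp
    moreover have "\<forall>\<^sub>F y in at x within ?B. norm (gradient u y - gradient u x) \<le> C * norm (y - x) powr \<alpha>"
      using H x by (auto simp: eventually_at_filter)
    ultimately have "((\<lambda>y. gradient u y - gradient u x) \<longlongrightarrow> 0) (at x within ?B)"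
      by (rule Lim_null_comparison[rotated])
    then show "(gradient u \<longlongrightarrow> gradient u x) (at x within ?B)" by (simp add: LIM_zero_iff)
  qed
  moreover have "\<forall>x\<in>?B. u differentiable (at x)"
    using GD unfolding gderiv_def differentiable_def by blast
  moreover have "bounded (u ` ?B)"
  proof -
    have "u ` ?B \<subseteq> {0..M0}" using gph_slab B\<Omega> by (force simp: slab_def)
    then show ?thesis by (rule bounded_subset[OF bounded_closed_interval])
  qed
  moreover have "bounded (gradient u ` ?B)"
  proof (rule boundedI)
    fix w assume "w \<in> gradient u ` ?B"
    then obtain x where x: "x \<in> ?B" "w = v x" using grad by auto
    then have "x \<in> \<Omega>" using B\<Omega> by auto
    then show "norm w \<le> Vmax" using steepness_le[OF F_target(2)[OF Y] gph_slab] x by (simp add: v_def)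
  qed
  ultimately have "C1_Holder_on \<alpha> ?B u" using H unfolding C1_Holder_on_def by blast
  then show ?thesis using H C by blast
qed

end

theorem theorem6p2:
  fixes \<kappa> M0 \<delta>0 C0 q \<alpha> :: real
    and \<Omega> :: "(real^'n::finite) set"
    and \<S> :: "'n point set"
    and s :: "'n point \<Rightarrow> 'n point \<Rightarrow> real"
    and \<sigma> :: "'n point measure"
    and u :: "real^'n \<Rightarrow> real"
    and xs :: "real^'n"
  assumes "CARD('n) \<ge> 2"
    and "0 < \<kappa>" "\<kappa> < 1" "M0 > 0" "0 < \<delta>0" "\<delta>0 < 1"
    and "open \<Omega>" "connected \<Omega>" "\<Omega> \<noteq> {}" "bounded \<Omega>"
    and "admissible_target \<kappa> M0 \<delta>0 \<Omega> \<S> s"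
    and "sets \<sigma> = sets (restrict_space borel \<S>)"
    and "parallel_refractor \<kappa> M0 \<Omega> \<S> u"
    and "(xs, u xs) \<in> cyl \<Omega> M0"
    and "regular_from \<kappa> M0 \<Omega> \<S> s (xs, u xs)"
    and "C0 > 0" "1 \<le> q" "q < real CARD('n) / (real CARD('n) - 1)"
    and "\<And>a \<eta>. \<eta> > 0 \<Longrightarrow> ball a \<eta> \<subseteq> \<Omega> \<Longrightarrow>
           emeasure \<sigma> (\<Union>x\<in>ball a \<eta>. refr_map \<kappa> \<Omega> \<S> u x)
             \<le> ennreal (C0 * \<eta> powr (real CARD('n) / q))"
    and "tube_condition \<kappa> M0 \<Omega> \<S> s \<sigma> (xs, u xs)"
    and "\<alpha> = (real CARD('n) / (2 * q) - (real CARD('n) - 1) / 2)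
             / (1 + 3 / 2 * (real CARD('n) - 1) + real CARD('n) / (2 * q))"
  shows "\<exists>\<delta> C. \<delta> > 0 \<and> C > 0 \<and> ball xs \<delta> \<subseteq> \<Omega>
           \<and> C1_Holder_on \<alpha> (ball xs \<delta>) u
           \<and> (\<forall>x1\<in>ball xs \<delta>. \<forall>x2\<in>ball xs \<delta>.
                norm (gradient u x1 - gradient u x2) \<le> C * norm (x1 - x2) powr \<alpha>)"
proof -
  interpret refractor \<kappa> M0 \<delta>0 \<Omega> \<S> s u
    by unfold_locales (use assms in auto)
  obtain \<delta> e K where "0 < \<delta>" "\<delta> \<le> 1 / 2" "0 < e" "0 < K" "ball xs \<delta> \<subseteq> \<Omega>"
    "\<And>x. x \<in> ball xs \<delta> \<Longrightarrow> gph x \<in> slab e"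
    "\<And>x1 x2 Y1 Y2. x1 \<in> ball xs \<delta> \<Longrightarrow> x2 \<in> ball xs \<delta> \<Longrightarrow> x1 \<noteq> x2 \<Longrightarrow> Y1 \<in> F x1 \<Longrightarrow> Y2 \<in> F x2
       \<Longrightarrow> norm (Y1 - Y2) \<le> K * norm (x1 - x2) powr \<alpha>"
    by (rule target_distance_estimate[OF assms(1,12,14,15,16,17,18,19,20,21)]) blast+
  from C1_Holder[OF exponent_bounds[OF assms(1,17,18,21)] this] \<open>0 < \<delta>\<close> \<open>ball xs \<delta> \<subseteq> \<Omega>\<close>
  show ?thesis by blast
qed

end
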